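(* Let $m\ge4$, let $k$ be a positive integer with $k<m$, let $\ell=\gcd(k,m)$, $f(x)=x^{2^k+1}$ on $\mathbb{F}_{2^m}$, and $D=\{x\in\mathbb{F}_{2^m}^*:\mathrm{Tr}(x)=1\}$. Let $\mathcal{C}(f)^{\bar D}=\{(\mathrm{Tr}(af(x)+bx))_{x\in D}:a,b\in\mathbb{F}_{2^m}\}$. Then: (1) If $v_2(m)\le v_2(k)$, then $\mathcal{C}(f)^{\bar D}$ is a $[2^{m-1},2m,2^{m-2}-2^{\frac{m+\ell-2}{2}}]$ binary code with weight distribution: weight $0$ once; weight $2^{m-2}$ with multiplicity $2^{2m}-2^{2m-\ell+1}+3\cdot2^{2m-2\ell-1}+2^{m-\ell-1}-2$; each of the weights $2^{m-2}\pm2^{\frac{m+\ell-2}{2}}$ with multiplicity $2^{2m-2\ell-2}-2^{m-\ell-2}$; each of the weights $2^{m-2}\pm2^{\frac{m+\ell-4}{2}}$ with multiplicity $2^{2m-\ell}-2^{2m-2\ell}$; weight $2^{m-1}$ once. If $\ell\ge2$, its dual has parameters $[2^{m-1},2^{m-1}-2m,4]$. If $\ell=1$, its dual has parameters $[2^{m-1},2^{m-1}-2m,6]$ and is distance-optimal with respect to the sphere packing bound. (2) If $v_2(m)>v_2(k)$ and $\gcd(m,k)=1$, then $\mathcal{C}(f)^{\bar D}$ is a $[2^{m-1},2m,2^{m-2}-2^{\frac m2}]$ binary code with weight distribution: weight $0$ once; weight $2^{m-2}$ with multiplicity $17\cdot2^{2m-5}+3\cdot2^{m-3}-2$; each of the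 weights $2^{m-2}\pm2^{\frac m2}$ with multiplicity $\frac13(2^{2m-6}-2^{m-4})$; each of the weights $2^{m-2}\pm2^{\frac{m-2}{2}}$ with multiplicity $\frac16(11\cdot2^{2m-3}-2^m)$; weight $2^{m-1}$ once. Its dual has parameters $[2^{m-1},2^{m-1}-2m,6]$ and is distance-optimal with respect to the sphere packing bound. (3) If $k=\frac m2$ and $m\ge4$, then $\mathcal{C}(f)^{\bar D}$ is a $[2^{m-1},\frac{3m}{2},2^{m-2}-2^{\frac{m-2}{2}}]$ binary code with weight distribution: weight $0$ once; weight $2^{m-2}$ with multiplicity $2^{\frac{3m}{2}-1}+2^{m-1}-2$; each of the weights $2^{m-2}\pm2^{\frac{m-2}{2}}$ with multiplicity $2^{\frac{3m}{2}-2}-2^{m-2}$; weight $2^{m-1}$ once. Its dual has parameters $[2^{m-1},2^{m-1}-\frac{3m}{2},4]$ and is distance-optimal with respect to the sphere packing bound.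
   Context: $\mathrm{Tr}$ is the absolute trace from $\mathbb{F}_{2^m}$ to $\mathbb{F}_2$; $v_2$ is the 2-adic order function. An $[n,k,d]$ binary code is a $k$-dimensional linear subspace of $\mathbb{F}_2^n$ with minimum Hamming distance $d$; the dual is taken with respect to the standard inner product. The multiplicity of a weight is the number of codewords of that weight. An $[n,k,d]$ binary code is distance-optimal if there is no $[n,k,d']$ binary linear code with $d'\ge d+1$; the phrase "with respect to the sphere packing bound" asserts distance-optimality in this sense, and names the bound $2^n\ge 2^k\sum_{i=0}^{\lfloor (d-1)/2\rfloor}\binom ni$ (valid for every $[n,k,d]$ binary code) as the bound used to establish it. The notation $\mathcal{C}(f)^{\bar D}$ indicates puncturing on $\bar D=\mathbb{F}_{2^m}^*\setminus D$.
   Formalization: Part (2) is stated for m≠4, since for m=4 its minimum distance would be 0 and the code has dimension at most 7, not 8; in part (3) distance-optimality of the dual is stated for m≠4, since for m=4 a binary [8,2,5] code exists. *)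

theory Defs
  imports "HOL-Analysis.Analysis" "HOL-Library.Z2"
    "HOL-Computational_Algebra.Primes"
begin

text \<open>
  The prime field of a field of characteristic 2 is identified with the type \<^typ>\<open>bit\<close>
  via \<open>0 \<mapsto> 0\<close>, \<open>1 \<mapsto> 1\<close>.  The power sum below lies in the prime field whenever the field
  has \<open>2 ^ m\<close> elements, see \<open>of_bit_abs_trace\<close>.
\<close>

definition abs_trace :: "nat \<Rightarrow> 'a::field \<Rightarrow> bit" where
  "abs_trace m x = of_bool ((\<Sum>i<m. x ^ (2 ^ i)) = 1)"

lemma of_bit_abs_trace:
  fixes x :: "'a::finite_field"
  assumes card: "CARD('a) = 2 ^ m"
  shows "of_bit (abs_trace m x) = (\<Sum>i<m. x ^ (2 ^ i))"
proof -
  define t where "t = (\<Sum>i<m. x ^ (2 ^ i))"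
  have "CHAR('a) dvd 2 ^ m"
  proof -
    have "(\<Sum>y\<in>(UNIV :: 'a set). y + 1) = (\<Sum>y\<in>UNIV. y)"
      by (rule sum.reindex_bij_witness[of _ "\<lambda>y. y - 1" "\<lambda>y. y + 1"]) auto
    then have "of_nat CARD('a) = (0 :: 'a)"
      by (simp add: sum.distrib)
    then show ?thesis
      using card by (metis of_nat_eq_0_iff_char_dvd)
  qed
  moreover have p: "prime CHAR('a)"
    by (rule prime_CHAR_semidom) (rule finite_imp_CHAR_pos, simp)
  ultimately have char: "CHAR('a) = 2"
    by (metis prime_dvd_power primes_dvd_imp_eq two_is_prime_nat)
  have "t ^ 2 = (\<Sum>i<m. (x ^ (2 ^ i)) ^ 2)"
    unfolding t_def by (rule freshmans_dream_sum) (use p char in auto)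
  also have "\<dots> = (\<Sum>i<m. x ^ (2 ^ Suc i))"
    by (simp add: mult.commute flip: power_mult)
  also have "\<dots> + x ^ (2 ^ 0) = t + x ^ (2 ^ m)"
    unfolding t_def using sum.lessThan_Suc_shift[of "\<lambda>i. x ^ (2 ^ i)" m]
    by (simp add: add.commute)
  also have "x ^ (2 ^ m) = x"
    using finite_field_power_card_eq_same[of x] card by simp
  finally have "t * (t - 1) = 0"
    by (simp add: power2_eq_square algebra_simps)
  then have "t = 0 \<or> t = 1"
    by simp
  then show ?thesis
    unfolding abs_trace_def t_def[symmetric] by auto
qed

text \<open>
  A binary code of length \<^term>\<open>CARD('n)\<close> is a set of vectors of type \<^typ>\<open>bit ^ 'n\<close>.
\<close>

definition hamming_dist :: "bit ^ 'n \<Rightarrow> bit ^ 'n \<Rightarrow> nat" where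
  "hamming_dist u v = card {i. u $ i \<noteq> v $ i}"

definition hamming_weight :: "bit ^ 'n \<Rightarrow> nat" where
  "hamming_weight c = card {i. c $ i \<noteq> 0}"

text \<open>
  The minimum distance is characterised relationally, so that the code \<open>{0}\<close>, which has no two
  distinct codewords, has no parameters at all.
\<close>

definition is_code :: "(bit ^ 'n) set \<Rightarrow> nat \<Rightarrow> nat \<Rightarrow> nat \<Rightarrow> bool" where
  "is_code C n k d \<longleftrightarrow>
     CARD('n) = n \<and> vec.subspace C \<and> vec.dim C = k \<and>
     (\<exists>u\<in>C. \<exists>v\<in>C. u \<noteq> v \<and> hamming_dist u v = d) \<and>
     (\<forall>u\<in>C. \<forall>v\<in>C. u \<noteq> v \<longrightarrow> d \<le> hamming_dist u v)"

definition dual_code :: "(bit ^ 'n) set \<Rightarrow> (bit ^ 'n) set" where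
  "dual_code C = {v. \<forall>u\<in>C. (\<Sum>i\<in>UNIV. u $ i * v $ i) = 0}"

definition distance_optimal :: "(bit ^ 'n) set \<Rightarrow> nat \<Rightarrow> nat \<Rightarrow> nat \<Rightarrow> bool" where
  "distance_optimal C n k d \<longleftrightarrow>
     is_code C n k d \<and>
     \<not> (\<exists>(C' :: (bit ^ 'n) set) d'. d' \<ge> d + 1 \<and> is_code C' n k d')"

text \<open>
  A weight distribution is given as the list of all occurring weights with their multiplicities.
  The multiplicities are real numbers because some of the closed formulas contain fractions.
\<close>

definition has_weight_distribution :: "(bit ^ 'n) set \<Rightarrow> (nat \<times> real) list \<Rightarrow> bool" where
  "has_weight_distribution C ws \<longleftrightarrow>
     distinct (map fst ws) \<and>
     (\<forall>(w, A) \<in> set ws. real (card {c \<in> C. hamming_weight c = w}) = A) \<and>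
     (\<forall>c\<in>C. hamming_weight c \<in> fst ` set ws)"

text \<open>
  The map \<open>e\<close> enumerates the coordinate set \<open>D\<close> that remains after puncturing.
\<close>

definition punctured_code :: "nat \<Rightarrow> ('a::field \<Rightarrow> 'a) \<Rightarrow> ('n \<Rightarrow> 'a) \<Rightarrow> (bit ^ 'n) set" where
  "punctured_code m f e = {(\<chi> i. abs_trace m (a * f (e i) + b * e i)) | a b. True}"

end

(*
Write q = 2^m, L = 2^l, chi(x) = (-1)^Tr(x), S(a,b) = sum_x chi(a x^(2^k+1) + b x) and let T(a,b) be
the same sum restricted to the points of trace 1, so that 2 T(a,b) = S(a,b) - S(a,b+1) and the
codeword of (a,b) has weight (q/2 - T(a,b))/2.  The exponent is a quadratic form, hence S(a,b)^2 is 0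
or q times the size of its radical {u. a^(2^k) u^(2^(2k)) = a u}, which is trivial or a
multiple of the fixed field of the 2k-th Frobenius power.  This leaves only the values 0, +-A, +-2A and +-q/2
for T; since T(a,b+1) = -T(a,b), opposite values are equally frequent, and the second and
fourth power moments of T determine all frequencies (for 2k = m the second one suffices, but 2^k pairs
(a,b) share a codeword).  The fourth moment counts the solutions of
x + y + z + w = 0, f(x) + f(y) + f(z) + f(w) = 0, i.e. of u^(2^k) v = u v^(2^k), which says that
v/u lies in the field with L elements; nontrivial solutions are the codewords of weight 4 of the dual.
The weights of the dual are even and different from 2, and the sphere packing bound limits its minimum
distance from above, except that a [16,6,7] code is excluded through its residual code.
*)
theory Submission
  imports Defs
begin

text \<open>Only the square of S is computed; the signs come from the symmetry between b and b+1.
  Under this symmetry the odd moments vanish, so the even moments of order 0, 2 and 4 serve as three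
  linear equations for the frequencies of 0, A and 2A. The cases differ in the radical for a nonzero
  a. In case (1) the 2-adic condition gives gcd(2k,m) = l and makes f injective, and the radical has
  exactly L elements, so A = sqrt(q L)/2. In case (2) gcd(2k,m) = 2 and the radical has 1 or 4
  elements: S is +-sqrt q, or one of 0 and +-2 sqrt q, and both possibilities fit A = sqrt q. In
  case (3) f is the norm onto the subfield with 2^k elements, on which the absolute trace vanishes.
  For a in that subfield the quadratic part therefore disappears, which is why 2^k pairs share a
  codeword; for a outside, the radical is trivial. Taking A = 2^k/2 with frequency 0 lets case (3)
  use the same equations. Frequencies count pairs (a,b) throughout and are divided by the size of
  the kernel only at the end.\<close>

text \<open>The default simp rules replace the field operations on \<^typ>\<open>bit\<close> by bit operations.\<close>

declare add_bit_eq_xor [simp del] mult_bit_eq_and [simp del] bit_not_zero_iff [simp del]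
  bit_not_one_iff [simp del]

lemma bit_one_add_one [simp]: "1 + 1 = (0 :: bit)"
  by (simp only: one_add_one bit_2_eq_0)

lemma bit_neq_zero_iff: "(a :: bit) \<noteq> 0 \<longleftrightarrow> a = 1"
  by (cases a) simp_all

lemma bit_add_self [simp]: "(a :: bit) + a = 0"
  by (cases a) simp_all

lemma bit_add_eq_0_iff: "(a :: bit) + b = 0 \<longleftrightarrow> a = b"
  by (cases a; cases b) simp_all

instance bit :: finite
proof
  have "(UNIV :: bit set) \<subseteq> {0, 1}" by (auto intro: bit.exhaust)
  then show "finite (UNIV :: bit set)" by (rule finite_subset) simp
qed

lemma card_bit [simp]: "CARD(bit) = 2"
proof -
  have "(UNIV :: bit set) = {0, 1}" by (auto intro: bit.exhaust)
  then have "CARD(bit) = card {0, 1 :: bit}" by (rule arg_cong)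
  then show ?thesis by simp
qed

section \<open>Real-valued characters and fibres of additive maps\<close>

definition bit_sign :: "bit \<Rightarrow> real" where
  "bit_sign b = (if b = 0 then 1 else - 1)"

lemma bit_sign_simps [simp]: "bit_sign 0 = 1" "bit_sign 1 = - 1"
  by (simp_all add: bit_sign_def)

lemma bit_sign_add: "bit_sign (a + b) = bit_sign a * bit_sign b"
  by (cases a; cases b) (simp_all add: bit_sign_def)

text \<open>Orthogonality: if \<open>h w = 1\<close>, translation by \<open>w\<close> permutes
  \<open>G\<close> and negates every summand. The set \<open>G\<close> is kept general because the
  sum is taken over whole spaces, over codes and over radicals.\<close>

lemma sum_additive_character:
  fixes h :: "'g::ab_group_add \<Rightarrow> bit"
  assumes fin: "finite G"
    and closed: "\<And>x y. x \<in> G \<Longrightarrow> y \<in> G \<Longrightarrow> x + y \<in> G"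
    and add: "\<And>x y. x \<in> G \<Longrightarrow> y \<in> G \<Longrightarrow> h (x + y) = h x + h y"
  shows "(\<Sum>x\<in>G. bit_sign (h x)) = (if \<forall>x\<in>G. h x = 0 then real (card G) else 0)"
proof (cases "\<forall>x\<in>G. h x = 0")
  case True
  then show ?thesis by simp
next
  case False
  then obtain w where w: "w \<in> G" "h w = 1" by (auto simp: bit_neq_zero_iff)
  have inj: "inj_on (\<lambda>x. x + w) G" by (simp add: inj_on_def)
  have "(\<lambda>x. x + w) ` G = G"
    by (rule endo_inj_surj) (use fin inj closed w in auto)
  then have "(\<Sum>x\<in>G. bit_sign (h x)) = (\<Sum>x\<in>G. bit_sign (h (x + w)))"
    using sum.reindex[OF inj, of "\<lambda>x. bit_sign (h x)"] by simp
  also have "\<dots> = - (\<Sum>x\<in>G. bit_sign (h x))"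
    by (subst sum_negf[symmetric], rule sum.cong) (use add w in \<open>auto simp: bit_sign_add\<close>)
  finally show ?thesis using False by auto
qed

text \<open>Nonempty fibres are cosets of the kernel. This later converts counts of pairs (a,b) into
  counts of codewords.\<close>

lemma card_additive_vimage:
  fixes \<Phi> :: "'g::{ab_group_add,finite} \<Rightarrow> 'h::ab_group_add"
  assumes add: "\<And>x y. \<Phi> (x + y) = \<Phi> x + \<Phi> y"
    and Y: "Y \<subseteq> range \<Phi>"
  shows "card {x. \<Phi> x \<in> Y} = card {x. \<Phi> x = 0} * card Y"
proof -
  have zero: "\<Phi> 0 = 0" using add[of 0 0] by simp
  have diff: "\<Phi> (x - y) = \<Phi> x - \<Phi> y" for x y
    using add[of "x - y" y] by (simp add: algebra_simps)
  have fib: "card {x. \<Phi> x = y} = card {x. \<Phi> x = 0}" if y: "y \<in> Y" for y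
  proof -
    obtain z where z: "\<Phi> z = y" using y Y by blast
    have "bij_betw (\<lambda>x. x + z) {x. \<Phi> x = 0} {x. \<Phi> x = y}"
      by (rule bij_betw_byWitness[where f' = "\<lambda>x. x - z"]) (auto simp: add diff z)
    then show ?thesis by (simp add: bij_betw_same_card)
  qed
  have finY: "finite Y" using Y by (rule finite_subset) simp
  have "{x. \<Phi> x \<in> Y} = (\<Union>y\<in>Y. {x. \<Phi> x = y})" by auto
  then have "card {x. \<Phi> x \<in> Y} = (\<Sum>y\<in>Y. card {x. \<Phi> x = y})"
    by (simp only:) (rule card_UN_disjoint, use finY in auto)
  also have "\<dots> = (\<Sum>y\<in>Y. card {x. \<Phi> x = 0})" by (rule sum.cong) (use fib in auto)
  finally show ?thesis by simp
qed

subsection \<open>Linear codes\<close>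

text \<open>Passing to supports turns addition into symmetric difference, the form in which packing
  arguments are carried out below.\<close>

definition supp :: "bit ^ 'n \<Rightarrow> 'n set" where
  "supp c = {i. c $ i \<noteq> 0}"

lemma hamming_weight_supp: "hamming_weight c = card (supp c)"
  by (simp add: hamming_weight_def supp_def)

lemma supp_eq_iff: "supp u = supp v \<longleftrightarrow> u = v"
proof
  assume *: "supp u = supp v"
  have "u $ i = v $ i" for i
    using * by (cases "u $ i"; cases "v $ i") (force simp: supp_def set_eq_iff)+
  then show "u = v" by (simp add: vec_eq_iff)
qed simp

lemma bit_vec_add_self: "(u :: bit ^ 'n) + u = 0"
  by (simp add: vec_eq_iff)

lemma bit_vec_diff: "(u :: bit ^ 'n) - v = u + v"
  by (simp add: vec_eq_iff)

lemma supp_add: "supp (u + v) = sym_diff (supp u) (supp v)"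
proof -
  have "i \<in> supp (u + v) \<longleftrightarrow> i \<in> sym_diff (supp u) (supp v)" for i
    by (cases "u $ i"; cases "v $ i") (auto simp: supp_def)
  then show ?thesis by blast
qed

lemma hamming_dist_add: "hamming_dist u v = hamming_weight (u + v)"
  by (simp add: hamming_dist_def hamming_weight_def bit_add_eq_0_iff)

lemma hamming_dist_supp: "hamming_dist u v = card (sym_diff (supp u) (supp v))"
  by (simp add: hamming_dist_add hamming_weight_supp supp_add)

lemma subspace_bitI:
  fixes S :: "(bit ^ 'n) set"
  assumes "0 \<in> S" and "\<And>u v. u \<in> S \<Longrightarrow> v \<in> S \<Longrightarrow> u + v \<in> S"
  shows "vec.subspace S"
proof (rule vec.subspaceI)
  fix c :: bit and x assume "x \<in> S"
  then show "c *s x \<in> S" using assms(1) by (cases c) auto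
qed (use assms in auto)

text \<open>Induction on a basis: the only scalars are 0 and 1, so a vector outside the span adds
  one disjoint translate of the span and doubles the size.\<close>

lemma card_subspace:
  fixes S :: "(bit ^ 'n) set"
  assumes "vec.subspace S"
  shows "card S = 2 ^ vec.dim S"
proof -
  obtain B where B: "B \<subseteq> S" "vec.independent B" "S \<subseteq> vec.span B" "card B = vec.dim S"
    using vec.basis_exists by blast
  have S: "S = vec.span B"
    using B assms by (metis vec.span_subspace)
  have finB: "finite B" using B(2) by (rule vec.finiteI_independent)
  have "card (vec.span B) = 2 ^ card B" using finB B(2)
  proof (induction B)
    case empty
    then show ?case by simp
  next
    case (insert b B)
    then have b: "b \<notin> vec.span B" and ind: "vec.independent B"
      by (auto simp: vec.independent_insert)
    have eq: "vec.span (insert b B) = vec.span B \<union> (\<lambda>x. x + b) ` vec.span B"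
    proof (intro equalityI subsetI)
      fix x assume "x \<in> vec.span (insert b B)"
      then obtain k where k: "x - k *s b \<in> vec.span B" by (auto simp: vec.span_insert)
      show "x \<in> vec.span B \<union> (\<lambda>x. x + b) ` vec.span B"
      proof (cases "k = 0")
        case True
        then show ?thesis using k by simp
      next
        case False
        then have "x = (x - k *s b) + b" by (simp add: bit_neq_zero_iff)
        then show ?thesis using k by blast
      qed
    next
      fix x assume "x \<in> vec.span B \<union> (\<lambda>x. x + b) ` vec.span B"
      then show "x \<in> vec.span (insert b B)"
        using vec.span_mono[of B "insert b B"]
        by (auto intro!: vec.span_add intro: vec.span_base)
    qed
    have "vec.span B \<inter> (\<lambda>x. x + b) ` vec.span B = {}"
    proof (rule ccontr)
      assume "\<not> ?thesis"
      then obtain x where "x \<in> vec.span B" "x + b \<in> vec.span B" by auto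
      then have "(x + b) - x \<in> vec.span B" using vec.span_diff by blast
      then show False using b by simp
    qed
    moreover have "card ((\<lambda>x. x + b) ` vec.span B) = card (vec.span B)"
      by (rule card_image) (simp add: inj_on_def)
    ultimately have "card (vec.span (insert b B)) = 2 * card (vec.span B)"
      unfolding eq by (subst card_Un_disjoint) auto
    then show ?case using insert ind by simp
  qed
  then show ?thesis using S B(4) by simp
qed

lemma dim_eq_of_card:
  fixes S :: "(bit ^ 'n) set"
  assumes "vec.subspace S" and "card S = 2 ^ k"
  shows "vec.dim S = k"
  using card_subspace[OF assms(1)] assms(2) by simp

lemma is_codeI:
  fixes S :: "(bit ^ 'n) set"
  assumes "CARD('n) = n" and S: "vec.subspace S" and "card S = 2 ^ k"
    and ex: "c \<in> S" "c \<noteq> 0" "hamming_weight c = d"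
    and le: "\<And>c. c \<in> S \<Longrightarrow> c \<noteq> 0 \<Longrightarrow> d \<le> hamming_weight c"
  shows "is_code S n k d"
  unfolding is_code_def
proof (intro conjI)
  show "vec.dim S = k" using assms by (intro dim_eq_of_card)
  show "\<exists>u\<in>S. \<exists>v\<in>S. u \<noteq> v \<and> hamming_dist u v = d"
    using ex vec.subspace_0[OF S] by (intro bexI[of _ c] bexI[of _ 0]) (auto simp: hamming_dist_add)
  show "\<forall>u\<in>S. \<forall>v\<in>S. u \<noteq> v \<longrightarrow> d \<le> hamming_dist u v"
  proof (intro ballI impI)
    fix u v assume uv: "u \<in> S" "v \<in> S" "u \<noteq> v"
    then have "u + v \<noteq> 0" by (metis bit_vec_diff right_minus_eq)
    then show "d \<le> hamming_dist u v"
      using le[of "u + v"] uv vec.subspace_add[OF S] by (simp add: hamming_dist_add)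
  qed
qed (use assms in auto)

section \<open>Sphere packing and the nonexistence of a [16,6,7] code\<close>

lemma sphere_packing_sets:
  assumes fin: "finite X" and sub: "\<F> \<subseteq> Pow X"
    and far: "\<And>A B. A \<in> \<F> \<Longrightarrow> B \<in> \<F> \<Longrightarrow> A \<noteq> B \<Longrightarrow> 2 * t < card (sym_diff A B)"
  shows "card \<F> * (\<Sum>i\<le>t. card X choose i) \<le> 2 ^ card X"
proof -
  define \<E> where "\<E> = {E. E \<subseteq> X \<and> card E \<le> t}"
  have "\<E> = (\<Union>i\<in>{..t}. {E. E \<subseteq> X \<and> card E = i})" by (auto simp: \<E>_def)
  then have "card \<E> = (\<Sum>i\<le>t. card {E. E \<subseteq> X \<and> card E = i})"
    by (simp only:) (rule card_UN_disjoint, use fin in auto)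
  also have "\<dots> = (\<Sum>i\<le>t. card X choose i)"
    by (simp add: n_subsets fin)
  finally have cardE: "card \<E> = (\<Sum>i\<le>t. card X choose i)" .
  \<comment> \<open>Disjointness of the balls of radius \<open>t\<close>: if two centres
    \<open>A\<close>, \<open>B\<close> reach the same set by errors \<open>E\<close>,
    \<open>E'\<close>, then they differ only inside \<open>E\<close> and \<open>E'\<close>, hence in
    at most \<open>2 * t\<close> points.\<close>
  have "inj_on (\<lambda>(A, E). sym_diff A E) (\<F> \<times> \<E>)"
  proof (rule inj_onI, clarify)
    fix A E B E'
    assume *: "A \<in> \<F>" "E \<in> \<E>" "B \<in> \<F>" "E' \<in> \<E>" "sym_diff A E = sym_diff B E'"
    have fE: "finite E" "finite E'" using * fin by (auto simp: \<E>_def intro: finite_subset)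
    have "sym_diff A B \<subseteq> E \<union> E'" using *(5) by blast
    then have "card (sym_diff A B) \<le> card (E \<union> E')" using fE by (intro card_mono) auto
    also have "\<dots> \<le> 2 * t" using card_Un_le[of E E'] *(2,4) by (auto simp: \<E>_def)
    finally have "A = B" using far *(1,3) by fastforce
    then show "A = B \<and> E = E'" using *(5) by blast
  qed
  moreover have "(\<lambda>(A, E). sym_diff A E) ` (\<F> \<times> \<E>) \<subseteq> Pow X"
    using sub by (auto simp: \<E>_def)
  ultimately have "card (\<F> \<times> \<E>) \<le> card (Pow X)"
    using fin by (intro card_inj_on_le) auto
  then show ?thesis using fin by (simp add: card_cartesian_product card_Pow cardE)
qed

lemma sphere_packing_code:
  fixes S :: "(bit ^ 'n) set"
  assumes "is_code S n k d" and "2 * t < d"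
  shows "2 ^ k * (\<Sum>i\<le>t. n choose i) \<le> 2 ^ n"
proof -
  have inj: "inj_on supp S" by (simp add: inj_on_def supp_eq_iff)
  have "card (supp ` S) * (\<Sum>i\<le>t. card (UNIV :: 'n set) choose i) \<le> 2 ^ card (UNIV :: 'n set)"
  proof (rule sphere_packing_sets)
    fix A B assume "A \<in> supp ` S" "B \<in> supp ` S" "A \<noteq> B"
    then obtain u v where "u \<in> S" "v \<in> S" "u \<noteq> v" "A = supp u" "B = supp v" by auto
    then show "2 * t < card (sym_diff A B)"
      using assms by (fastforce simp: is_code_def hamming_dist_supp)
  qed auto
  then show ?thesis
    using assms card_subspace[of S] by (auto simp: is_code_def card_image[OF inj])
qed

text \<open>
  Puncturing a \<open>[16, 6, d]\<close> code on the support of a codeword of minimum weight leaves a residual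
  code of length \<open>16 - d\<close>, dimension 5 and minimum distance at least \<open>d / 2\<close>.  For \<open>d \<ge> 7\<close>,
  deleting one further coordinate contradicts the sphere packing bound with radius 1.
\<close>

lemma no_code_16_6_7:
  fixes S :: "(bit ^ 'n) set"
  assumes "is_code S 16 6 d"
  shows "d \<le> 6"
proof (rule ccontr)
  assume "\<not> d \<le> 6"
  then have d7: "d \<ge> 7" by simp
  have n: "CARD('n) = 16" and S: "vec.subspace S" and dim: "vec.dim S = 6"
    and far: "\<And>u v. u \<in> S \<Longrightarrow> v \<in> S \<Longrightarrow> u \<noteq> v \<Longrightarrow> d \<le> hamming_dist u v"
    using assms by (auto simp: is_code_def)
  obtain u0 v0 where uv0: "u0 \<in> S" "v0 \<in> S" "u0 \<noteq> v0" "hamming_dist u0 v0 = d"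
    using assms by (auto simp: is_code_def)
  define c where "c = u0 + v0"
  have cS: "c \<in> S" using uv0 S by (simp add: c_def vec.subspace_add)
  have cw: "card (supp c) = d" using uv0 by (simp add: c_def hamming_dist_add hamming_weight_supp)
  have min: "d \<le> card (supp u)" if "u \<in> S" "u \<noteq> 0" for u
    using far[of u 0] that vec.subspace_0[OF S] by (simp add: hamming_dist_add hamming_weight_supp)
  obtain i where i: "i \<in> supp c" using cw d7 by fastforce
  \<comment> \<open>The word \<open>c\<close> vanishes on \<open>Z\<close>, so it must be factored
    out before restricting to \<open>Z\<close>. Requiring coordinate \<open>i\<close> of its support
    to be 0 selects a complement of \<open>c\<close> in \<open>S\<close>.\<close>
  define S0 where "S0 = {u \<in> S. u $ i = 0}"
  define Z where "Z = - supp c"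
  \<comment> \<open>If \<open>Z\<close> is empty, the choice is arbitrary and nothing is removed;
    the bound 8 on the size holds then as well.\<close>
  define Z' where "Z' = Z - {SOME z. z \<in> Z}"
  have cZ: "card Z = 16 - d" unfolding Z_def using n cw by (simp add: card_Diff_subset Compl_eq_Diff_UNIV)
  have cZ': "card Z' \<le> 8"
  proof -
    have "card Z' \<le> card Z - 1"
      by (cases "Z = {}") (simp_all add: Z'_def some_in_eq card_Diff_singleton)
    then show ?thesis using cZ d7 by simp
  qed
  \<comment> \<open>The words \<open>u\<close> and \<open>u + c\<close> agree on \<open>Z\<close>
    and split \<open>supp c\<close> between them. Adding their two weights gives
    \<open>2 * d\<close> at most twice the weight on \<open>Z\<close> plus \<open>d\<close>, so the
    weight on \<open>Z\<close> is at least 7/2, hence 4.\<close>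
  have half: "4 \<le> card (supp u \<inter> Z)" if "u \<in> S" "u \<noteq> 0" "u \<noteq> c" for u
  proof -
    have "u + c \<noteq> 0" using that by (metis bit_vec_diff right_minus_eq)
    then have "d \<le> card (sym_diff (supp u) (supp c))"
      using min[of "u + c"] that cS S by (simp add: vec.subspace_add supp_add)
    also have "sym_diff (supp u) (supp c) = (supp u \<inter> Z) \<union> (supp c - supp u)"
      by (auto simp: Z_def)
    also have "card \<dots> \<le> card (supp u \<inter> Z) + card (supp c - supp u)" by (rule card_Un_le)
    finally have 1: "d \<le> card (supp u \<inter> Z) + card (supp c - supp u)" .
    have "d \<le> card (supp u)" using min that by simp
    also have "supp u = (supp u \<inter> Z) \<union> (supp c \<inter> supp u)"
      by (auto simp: Z_def)
    also have "card \<dots> \<le> card (supp u \<inter> Z) + card (supp c \<inter> supp u)" by (rule card_Un_le)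
    finally have 2: "d \<le> card (supp u \<inter> Z) + card (supp c \<inter> supp u)" .
    have "card (supp c) = card (supp c \<inter> supp u) + card (supp c - supp u)"
      by (subst card_Un_disjoint[symmetric]) (auto intro: arg_cong[where f = card])
    then show ?thesis using 1 2 cw d7 by linarith
  qed
  have half': "3 \<le> card (sym_diff (supp u \<inter> Z') (supp v \<inter> Z'))"
    if "u \<in> S0" "v \<in> S0" "u \<noteq> v" for u v
  proof -
    have "u + v \<in> S" using that S by (simp add: S0_def vec.subspace_add)
    moreover have "u + v \<noteq> 0" using that by (metis bit_vec_diff right_minus_eq)
    moreover have "u + v \<noteq> c"
    proof
      assume "u + v = c"
      then have "c $ i = 0" using that by (auto simp: S0_def)
      then show False using i by (simp add: supp_def)
    qed
    ultimately have "4 \<le> card (supp (u + v) \<inter> Z)" by (rule half)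
    also have "supp (u + v) \<inter> Z \<subseteq> insert (SOME z. z \<in> Z)
        (sym_diff (supp u \<inter> Z') (supp v \<inter> Z'))"
      by (auto simp: supp_add Z'_def)
    then have "card (supp (u + v) \<inter> Z) \<le> card (insert (SOME z. z \<in> Z)
        (sym_diff (supp u \<inter> Z') (supp v \<inter> Z')))" by (intro card_mono) auto
    also have "\<dots> \<le> Suc (card (sym_diff (supp u \<inter> Z') (supp v \<inter> Z')))"
      by (rule card_insert_le_m1) auto
    finally show ?thesis by simp
  qed
  have inj: "inj_on (\<lambda>u. supp u \<inter> Z') S0"
  proof (rule inj_onI, rule ccontr)
    fix u v assume "u \<in> S0" "v \<in> S0" "supp u \<inter> Z' = supp v \<inter> Z'" "u \<noteq> v"
    then show False using half'[of u v] by simp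
  qed
  have "card ((\<lambda>u. supp u \<inter> Z') ` S0) * (\<Sum>i\<le>1. card Z' choose i) \<le> 2 ^ card Z'"
  proof (rule sphere_packing_sets)
    fix A B assume "A \<in> (\<lambda>u. supp u \<inter> Z') ` S0" "B \<in> (\<lambda>u. supp u \<inter> Z') ` S0" "A \<noteq> B"
    then obtain u v where "u \<in> S0" "v \<in> S0" "u \<noteq> v" "A = supp u \<inter> Z'" "B = supp v \<inter> Z'" by auto
    then show "2 * 1 < card (sym_diff A B)" using half'[of u v] by simp
  qed auto
  moreover have "card S0 = 32"
  proof -
    have "S = S0 \<union> (\<lambda>u. u + c) ` S0"
    proof (intro equalityI subsetI)
      fix u assume u: "u \<in> S"
      show "u \<in> S0 \<union> (\<lambda>u. u + c) ` S0"
      proof (cases "u $ i = 0")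
        case True
        then show ?thesis using u by (simp add: S0_def)
      next
        case False
        then have "u + c \<in> S0" using u cS S i
          by (auto simp: S0_def vec.subspace_add supp_def bit_neq_zero_iff)
        moreover have "u = (u + c) + c" by (simp add: add.assoc bit_vec_add_self)
        ultimately show ?thesis by blast
      qed
    next
      fix u assume "u \<in> S0 \<union> (\<lambda>u. u + c) ` S0"
      then show "u \<in> S" using cS S by (auto simp: S0_def vec.subspace_add)
    qed
    moreover have "S0 \<inter> (\<lambda>u. u + c) ` S0 = {}"
      using i by (auto simp: S0_def supp_def)
    moreover have "card ((\<lambda>u. u + c) ` S0) = card S0"
      by (rule card_image) (simp add: inj_on_def)
    ultimately have "card S = 2 * card S0"
      by (metis card_Un_disjoint finite mult_2)
    then show ?thesis using card_subspace[OF S] dim by simp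
  qed
  \<comment> \<open>For a set of size 8 this would say that 288 is at most 256, and it fails for all
    smaller sizes too.\<close>
  ultimately have "32 * (1 + card Z') \<le> 2 ^ card Z'" by (simp add: card_image[OF inj])
  moreover have "card Z' \<in> {0..8}" using cZ' by simp
  moreover have "{0..8} = {0,1,2,3,4,5,6,7,8::nat}" by auto
  ultimately show False by auto
qed

section \<open>Duality and minimum distance\<close>

lemma subspace_dual_code: "vec.subspace (dual_code S)"
  by (rule subspace_bitI) (auto simp: dual_code_def distrib_left sum.distrib)

text \<open>Double counting of the signs of all inner products: summing over \<open>S\<close> first
  leaves the dual code, summing over the whole space first leaves only \<open>u = 0\<close>.\<close>

lemma card_dual_code:
  fixes S :: "(bit ^ 'n) set"
  assumes S: "vec.subspace S"
  shows "card S * card (dual_code S) = 2 ^ CARD('n)"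
proof -
  have "(\<Sum>v\<in>UNIV. \<Sum>u\<in>S. bit_sign (\<Sum>i\<in>UNIV. u $ i * v $ i)) =
      (\<Sum>v\<in>UNIV. if v \<in> dual_code S then real (card S) else 0)"
  proof (rule sum.cong)
    fix v :: "bit ^ 'n"
    have "(\<Sum>u\<in>S. bit_sign (\<Sum>i\<in>UNIV. u $ i * v $ i)) =
      (if \<forall>u\<in>S. (\<Sum>i\<in>UNIV. u $ i * v $ i) = 0 then real (card S) else 0)"
      by (rule sum_additive_character)
        (use S in \<open>auto simp: vec.subspace_add distrib_right sum.distrib\<close>)
    then show "(\<Sum>u\<in>S. bit_sign (\<Sum>i\<in>UNIV. u $ i * v $ i)) =
        (if v \<in> dual_code S then real (card S) else 0)"
      by (simp add: dual_code_def)
  qed auto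
  also have "\<dots> = real (card (dual_code S)) * real (card S)"
    by (simp add: sum.If_cases)
  finally have 1: "(\<Sum>v\<in>UNIV. \<Sum>u\<in>S. bit_sign (\<Sum>i\<in>UNIV. u $ i * v $ i)) =
      real (card (dual_code S)) * real (card S)" .
  have "(\<Sum>v\<in>UNIV. \<Sum>u\<in>S. bit_sign (\<Sum>i\<in>UNIV. u $ i * v $ i)) =
      (\<Sum>u\<in>S. \<Sum>v\<in>UNIV. bit_sign (\<Sum>i\<in>UNIV. u $ i * v $ i))"
    by (rule sum.swap)
  also have "\<dots> = (\<Sum>u\<in>S. if u = 0 then real (card (UNIV :: (bit ^ 'n) set)) else 0)"
  proof (rule sum.cong)
    fix u :: "bit ^ 'n"
    have "(\<Sum>v\<in>UNIV. bit_sign (\<Sum>i\<in>UNIV. u $ i * v $ i)) =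
      (if \<forall>v\<in>UNIV. (\<Sum>i\<in>UNIV. u $ i * v $ i) = 0 then real (card (UNIV :: (bit ^ 'n) set)) else 0)"
      by (rule sum_additive_character) (auto simp: distrib_left sum.distrib)
    moreover have "(\<forall>v\<in>UNIV. (\<Sum>i\<in>UNIV. u $ i * v $ i) = 0) \<longleftrightarrow> u = 0"
    proof
      assume *: "\<forall>v\<in>UNIV. (\<Sum>i\<in>UNIV. u $ i * v $ i) = 0"
      show "u = 0" unfolding vec_eq_iff
      proof
        fix j
        have "(\<Sum>i\<in>UNIV. u $ i * axis j (1::bit) $ i) = u $ j"
          by (simp add: axis_def if_distrib[where f = "\<lambda>x. _ * x"] cong: if_cong)
        then show "u $ j = 0 $ j" using * by simp
      qed
    qed auto
    ultimately show "(\<Sum>v\<in>UNIV. bit_sign (\<Sum>i\<in>UNIV. u $ i * v $ i)) =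
      (if u = 0 then real (card (UNIV :: (bit ^ 'n) set)) else 0)" by simp
  qed auto
  also have "\<dots> = real (card (UNIV :: (bit ^ 'n) set))"
    using vec.subspace_0[OF S] by simp
  finally have "real (card (dual_code S) * card S) = real (card (UNIV :: (bit ^ 'n) set))"
    using 1 by simp
  moreover have "card (UNIV :: (bit ^ 'n) set) = 2 ^ CARD('n)"
    by simp
  ultimately show ?thesis by (simp only: of_nat_eq_iff mult.commute)
qed

text \<open>The positive multiplicity guarantees that the least nonzero weight of the table is
  attained.\<close>

lemma code_of_weight_distribution:
  fixes S :: "(bit ^ 'n) set"
  assumes "CARD('n) = n" and S: "vec.subspace S" "card S = 2 ^ k"
    and W: "has_weight_distribution S ws"
    and d: "(d, A) \<in> set ws" "A > 0" "d > 0"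
    and le: "\<And>w A. (w, A) \<in> set ws \<Longrightarrow> w = 0 \<or> d \<le> w"
  shows "is_code S n k d"
proof -
  have "real (card {c \<in> S. hamming_weight c = d}) = A"
    using W d by (auto simp: has_weight_distribution_def)
  then have "{c \<in> S. hamming_weight c = d} \<noteq> {}" using d by force
  then obtain c where c: "c \<in> S" "hamming_weight c = d" by blast
  have ge: "d \<le> hamming_weight u" if "u \<in> S" "u \<noteq> 0" for u
  proof -
    have "hamming_weight u \<noteq> 0"
    proof
      assume "hamming_weight u = 0"
      then have "supp u = supp 0" by (simp add: hamming_weight_supp supp_def)
      then show False using that by (simp add: supp_eq_iff)
    qed
    moreover have "hamming_weight u \<in> fst ` set ws"
      using W that by (auto simp: has_weight_distribution_def)
    ultimately show ?thesis using le by fastforce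
  qed
  have "c \<noteq> 0" using c d by (auto simp: hamming_weight_def)
  then show ?thesis using assms(1) S c ge by (intro is_codeI) auto
qed

lemma of_nat_bit_eq_0_iff: "(of_nat n :: bit) = 0 \<longleftrightarrow> even n"
proof (induction n)
  case (Suc n)
  then show ?case by (cases "of_nat n :: bit") auto
qed simp

text \<open>Provides a minimum distance for the dual code before its value is known; it is then
  enclosed between two bounds.\<close>

lemma ex_is_code:
  fixes S :: "(bit ^ 'n) set"
  assumes "CARD('n) = n" and S: "vec.subspace S" "card S = 2 ^ k" and k: "k > 0"
  shows "\<exists>d. is_code S n k d"
proof -
  have "\<not> S \<subseteq> {0}"
  proof
    assume "S \<subseteq> {0}"
    then have "card S \<le> card {0 :: bit ^ 'n}" by (intro card_mono) auto
    then show False using S k one_less_power[of "2::nat" k] by simp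
  qed
  then obtain c where "c \<in> S \<and> c \<noteq> 0" by blast
  then obtain c where c: "c \<in> S \<and> c \<noteq> 0" "\<forall>u. u \<in> S \<and> u \<noteq> 0 \<longrightarrow> hamming_weight c \<le> hamming_weight u"
    using ex_has_least_nat[of "\<lambda>c. c \<in> S \<and> c \<noteq> 0" c hamming_weight] by blast
  then have "is_code S n k (hamming_weight c)"
    using assms by (intro is_codeI) auto
  then show ?thesis by blast
qed

subsection \<open>Arithmetic of the parameters\<close>

lemma choose_sum_2: "2 * (\<Sum>i\<le>2. n choose i) = n ^ 2 + n + 2"
proof -
  have "2 * (n choose 2) + n = n ^ 2"
    by (cases n) (auto simp: choose_two power2_eq_square algebra_simps)
  then show ?thesis by (simp add: numeral_2_eq_2)
qed

text \<open>Summing Pascal's rule reduces the step to radius 2; the factor 6 avoids division in the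
  natural numbers.\<close>

lemma choose_sum_3: "6 * (\<Sum>i\<le>3. n choose i) = n ^ 3 + 5 * n + 6"
proof (induction n)
  case (Suc n)
  have "(\<Sum>i\<le>3. Suc n choose i) = (\<Sum>i\<le>3. n choose i) + (\<Sum>i\<le>2. n choose i)"
    by (simp add: numeral_2_eq_2 numeral_3_eq_3)
  then show ?case using Suc choose_sum_2[of n]
    by (simp add: algebra_simps power2_eq_square power3_eq_cube)
qed (simp add: numeral_3_eq_3)

text \<open>Distance 7 would allow balls of radius 3. With n = 2^(m-1) there are 2 m = log2 (4 n^2)
  check bits, so n^3 + 5 n + 6 would be at most 24 n^2, which is false once n is at least 32. For n
  = 16 the packing inequality holds, hence the separate treatment of m = 5.\<close>

lemma distance_le_6:
  fixes S :: "(bit ^ 'n) set"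
  assumes m: "m \<ge> 5" and S: "is_code S (2 ^ (m - 1)) (2 ^ (m - 1) - 2 * m) d"
  shows "d \<le> 6"
proof (cases "m = 5")
  case True
  then show ?thesis using S no_code_16_6_7 by simp
next
  case False
  show ?thesis
  proof (rule ccontr)
    assume "\<not> d \<le> 6"
    define n :: nat where "n = 2 ^ (m - 1)"
    have n32: "n \<ge> 32" using m False power_increasing[of 5 "m - 1" "2::nat"] by (simp add: n_def)
    have "2 ^ (2 * m) = (2 * n) ^ 2"
      using m by (simp add: n_def power_mult[symmetric] mult.commute flip: power_Suc)
    have "2 ^ (n - 2 * m) * (\<Sum>i\<le>3. n choose i) \<le> 2 ^ n"
      using S \<open>\<not> d \<le> 6\<close> unfolding n_def by (intro sphere_packing_code[of S _ _ d]) auto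
    \<comment> \<open>As an inequality this is valid even where the subtraction truncates.\<close>
    also have "\<dots> \<le> 2 ^ (n - 2 * m) * 2 ^ (2 * m)"
      unfolding power_add[symmetric] by (intro power_increasing) auto
    finally have "(\<Sum>i\<le>3. n choose i) \<le> 2 ^ (2 * m)" by simp
    then have "6 * (\<Sum>i\<le>3. n choose i) \<le> 24 * n ^ 2"
      using \<open>2 ^ (2 * m) = (2 * n) ^ 2\<close> by (simp add: power2_eq_square)
    then have "n ^ 3 + 5 * n + 6 \<le> 24 * n ^ 2" unfolding choose_sum_3 .
    moreover have "24 * n ^ 2 \<le> n ^ 3"
      using n32 by (simp add: power2_eq_square power3_eq_cube)
    ultimately show False by simp
  qed
qed

text \<open>Distance 5 would allow balls of radius 2, so n^2 + n + 2 would be at most 2^(3h+1). Here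
  n^2 = 2^(4h-2), and 3h+1 is at most 4h-2 exactly from h = 3 on.\<close>

lemma distance_le_4:
  fixes S :: "(bit ^ 'n) set"
  assumes h: "h \<ge> 3" and S: "is_code S (2 ^ (2 * h - 1)) (2 ^ (2 * h - 1) - 3 * h) d"
  shows "d \<le> 4"
proof (rule ccontr)
  assume "\<not> d \<le> 4"
  define n :: nat where "n = 2 ^ (2 * h - 1)"
  have "2 ^ (n - 3 * h) * (\<Sum>i\<le>2. n choose i) \<le> 2 ^ n"
    using S \<open>\<not> d \<le> 4\<close> unfolding n_def by (intro sphere_packing_code[of S _ _ d]) auto
  also have "\<dots> \<le> 2 ^ (n - 3 * h) * 2 ^ (3 * h)"
    unfolding power_add[symmetric] by (intro power_increasing) auto
  finally have "(\<Sum>i\<le>2. n choose i) \<le> 2 ^ (3 * h)" by simp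
  then have "n ^ 2 + n + 2 \<le> 2 * 2 ^ (3 * h)" using choose_sum_2[of n] by simp
  also have "\<dots> = 2 ^ (3 * h + 1)" by simp
  also have "\<dots> \<le> 2 ^ (2 * (2 * h - 1))" using h by (intro power_increasing) auto
  also have "\<dots> = n ^ 2" by (simp add: n_def power_mult[symmetric] mult.commute)
  finally show False by simp
qed

lemma sum_lessThan_add:
  fixes f :: "nat \<Rightarrow> 'b::comm_monoid_add"
  shows "(\<Sum>i<k + n. f i) = (\<Sum>i<k. f i) + (\<Sum>i<n. f (k + i))"
  by (induction n) (simp_all add: add.assoc)

text \<open>After division by the gcd, k' and m' are coprime. An even m' would force k' to be odd
  and give m the larger 2-adic order, so m' is odd, and doubling k' creates no common factor with
  it.\<close>

lemma gcd_double_of_multiplicity_le: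
  fixes k m :: nat
  assumes "0 < k" "0 < m" and le: "multiplicity 2 m \<le> multiplicity 2 k"
  shows "gcd (2 * k) m = gcd k m" and "odd (m div gcd k m)"
proof -
  define l where "l = gcd k m"
  have l0: "l > 0" using assms by (simp add: l_def)
  obtain k' m' where k': "k = l * k'" and m': "m = l * m'"
    unfolding l_def by (meson dvdE gcd_dvd1 gcd_dvd2)
  have cop: "coprime k' m'"
    using gcd_mult_distrib_nat[of l k' m'] l0 unfolding k'[symmetric] m'[symmetric] l_def[symmetric]
    by (simp add: coprime_iff_gcd_eq_1)
  have pos: "k' > 0" "m' > 0" using assms k' m' by auto
  have mult: "multiplicity 2 (l * x) = multiplicity 2 l + multiplicity 2 x" if "x > 0" for x :: nat
    using that l0 by (intro prime_elem_multiplicity_mult_distrib) auto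
  have odd: "odd m'"
  proof
    assume even: "even m'"
    then have "odd k'" using cop by (metis coprime_common_divisor odd_one)
    then have "multiplicity 2 k' = 0" by (rule not_dvd_imp_multiplicity_0)
    moreover have "multiplicity 2 m' \<noteq> 0"
      using even pos by (simp add: multiplicity_eq_zero_iff)
    ultimately show False using le mult[OF pos(1)] mult[OF pos(2)] unfolding k'[symmetric] m'[symmetric]
      by simp
  qed
  then show "odd (m div gcd k m)" unfolding l_def[symmetric] using l0 by (simp add: m')
  have "coprime (2 * k') m'" using odd cop by simp
  then have "gcd (2 * k) m = l"
    using gcd_mult_distrib_nat[of l "2 * k'" m'] by (simp add: k' m' mult.left_commute)
  then show "gcd (2 * k) m = gcd k m" by (simp add: l_def)
qed

text \<open>Rewrites the solved moment equations as the stated closed forms. Substituting m = l + 2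
  + t turns every truncated difference in an exponent into a sum, after which only polynomial
  identities in 2^l and 2^t remain.\<close>

lemma multiplicities_multiplicity_le:
  fixes N0 N1 N2 :: real
  assumes "l + 2 \<le> m"
    and 2: "(2 ^ l) ^ 2 * N2 = ((2 ^ m) ^ 2 - 2 ^ m * 2 ^ l) / 4"
    and 1: "(2 ^ l) ^ 2 * N1 = (2 ^ m) ^ 2 * 2 ^ l - (2 ^ m) ^ 2"
    and 0: "N0 = (2 ^ m) ^ 2 - 2 - 2 * N1 - 2 * N2"
  shows "N2 = 2 ^ (2 * m - 2 * l - 2) - 2 ^ (m - l - 2)"
    and "N1 = 2 ^ (2 * m - l) - 2 ^ (2 * m - 2 * l)"
    and "N0 = 2 ^ (2 * m) - 2 ^ (2 * m - l + 1) + 3 * 2 ^ (2 * m - 2 * l - 1) + 2 ^ (m - l - 1) - 2"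
proof -
  obtain t where m: "m = l + 2 + t" using assms(1) by (metis le_iff_add)
  define L T :: real where "L = 2 ^ l" and "T = 2 ^ t"
  have L: "L \<noteq> 0" by (simp add: L_def)
  have q2: "(2::real) ^ (2 * m) = 2 ^ m * 2 ^ m" by (simp add: mult_2 power_add)
  have q: "2 ^ m = 4 * L * T" by (simp add: m power_add L_def T_def)
  have exps: "2 * m - 2 * l - 2 = t + t + 2" "m - l - 2 = t" "2 * m - l = l + t + t + 4"
    "2 * m - 2 * l = t + t + 4" "2 * m - 2 * l - 1 = t + t + 3" "m - l - 1 = t + 1"
    by (simp_all add: m)
  have "L ^ 2 * N2 = L ^ 2 * (4 * T ^ 2 - T)"
    using 2 unfolding q L_def[symmetric] by (simp add: algebra_simps power2_eq_square)
  then have N2: "N2 = 4 * T ^ 2 - T" using L by simp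
  have "L ^ 2 * N1 = L ^ 2 * (16 * L * T ^ 2 - 16 * T ^ 2)"
    using 1 unfolding q L_def[symmetric] by (simp add: algebra_simps power2_eq_square)
  then have N1: "N1 = 16 * L * T ^ 2 - 16 * T ^ 2" using L by simp
  have N0: "N0 = 16 * L ^ 2 * T ^ 2 - 32 * L * T ^ 2 + 24 * T ^ 2 + 2 * T - 2"
    using 0 unfolding N1 N2 q by (simp add: algebra_simps power2_eq_square)
  show "N2 = 2 ^ (2 * m - 2 * l - 2) - 2 ^ (m - l - 2)"
    unfolding exps(1,2) N2 power_add by (simp add: T_def power2_eq_square)
  show "N1 = 2 ^ (2 * m - l) - 2 ^ (2 * m - 2 * l)"
    unfolding exps(3,4) N1 power_add by (simp add: T_def L_def power2_eq_square)
  show "N0 = 2 ^ (2 * m) - 2 ^ (2 * m - l + 1) + 3 * 2 ^ (2 * m - 2 * l - 1) + 2 ^ (m - l - 1) - 2"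
    unfolding q2 exps(3,5,6) N0 power_add q T_def[symmetric] L_def[symmetric]
    by (simp add: power2_eq_square)
qed

lemma multiplicities_coprime:
  fixes N0 N1 N2 :: real
  assumes "4 \<le> m"
    and 2: "N2 = ((2 ^ m) ^ 2 / 64 - 2 ^ m / 16) / 3"
    and 1: "N1 = (11 * (2 ^ m) ^ 2 / 8 - 2 ^ m) / 6"
    and 0: "N0 = (2 ^ m) ^ 2 - 2 - 2 * N1 - 2 * N2"
  shows "N2 = 1 / 3 * (2 ^ (2 * m - 6) - 2 ^ (m - 4))"
    and "N1 = 1 / 6 * (11 * 2 ^ (2 * m - 3) - 2 ^ m)"
    and "N0 = 17 * 2 ^ (2 * m - 5) + 3 * 2 ^ (m - 3) - 2"
proof -
  obtain t where m: "m = 4 + t" using assms(1) by (metis le_iff_add)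
  define T :: real where "T = 2 ^ t"
  have q: "2 ^ m = 16 * T" by (simp add: m power_add T_def)
  have exps: "2 * m - 6 = t + t + 2" "m - 4 = t" "2 * m - 3 = t + t + 5" "2 * m - 5 = t + t + 3" "m - 3 = t + 1"
    by (simp_all add: m)
  show "N2 = 1 / 3 * (2 ^ (2 * m - 6) - 2 ^ (m - 4))"
    unfolding exps 2 power_add q by (simp add: power2_eq_square flip: T_def)
  show "N1 = 1 / 6 * (11 * 2 ^ (2 * m - 3) - 2 ^ m)"
    unfolding exps 1 power_add q by (simp add: power2_eq_square flip: T_def)
  show "N0 = 17 * 2 ^ (2 * m - 5) + 3 * 2 ^ (m - 3) - 2"
    unfolding exps 0 1 2 power_add q by (simp add: field_simps power2_eq_square flip: T_def)
qed

lemma multiplicities_half: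
  fixes N0 N1 :: real
  assumes "2 \<le> k" and m: "m = 2 * k"
    and 1: "N1 = ((2 ^ m) ^ 2 - 2 ^ m * 2 ^ k) / 4"
    and 0: "N0 = (2 ^ m) ^ 2 - 2 * 2 ^ k - 2 * N1"
  shows "N1 = 2 ^ k * (2 ^ (3 * m div 2 - 2) - 2 ^ (m - 2))"
    and "N0 = 2 ^ k * (2 ^ (3 * m div 2 - 1) + 2 ^ (m - 1) - 2)"
proof -
  obtain t where k: "k = 2 + t" using assms(1) by (metis le_iff_add)
  define T :: real where "T = 2 ^ t"
  have K: "2 ^ k = 4 * T" by (simp add: k power_add T_def)
  have m': "m = t + t + 4" by (simp add: m k)
  have q: "2 ^ m = 16 * T * T" unfolding m' power_add T_def by simp
  have exps: "3 * m div 2 - 2 = t + t + t + 4" "m - 2 = t + t + 2" "3 * m div 2 - 1 = t + t + t + 5"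
    "m - 1 = t + t + 3" by (simp_all add: m k)
  show "N1 = 2 ^ k * (2 ^ (3 * m div 2 - 2) - 2 ^ (m - 2))"
    unfolding exps 1 power_add q K by (simp add: field_simps power2_eq_square flip: T_def)
  show "N0 = 2 ^ k * (2 ^ (3 * m div 2 - 1) + 2 ^ (m - 1) - 2)"
    unfolding exps 0 1 power_add q K by (simp add: field_simps power2_eq_square flip: T_def)
qed

text \<open>The listed set is the common shape of the three weight tables; for the table with five
  weights, \<open>a\<close> and \<open>b\<close> coincide.\<close>

lemma le_if_weight:
  fixes X a b w :: nat
  assumes "b \<le> a" and "w \<in> {0, X, X + a, X - a, X + b, X - b, 2 * X}"
  shows "w = 0 \<or> X - a \<le> w"
  using assms by auto

lemma double_less_two_power: "m \<ge> 5 \<Longrightarrow> 2 * m < 2 ^ (m - 1)" for m :: nat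
proof (induction m rule: nat_induct_at_least)
  case (Suc m)
  then show ?case by (cases m) auto
qed simp

subsection \<open>Finite fields of characteristic two\<close>

locale binary_field =
  fixes F :: "'a::finite_field itself" and m :: nat
  assumes card_F: "CARD('a) = 2 ^ m"
begin

lemma m_pos: "0 < m"
proof (rule ccontr)
  assume "\<not> 0 < m"
  then have "CARD('a) = 1" using card_F by simp
  then obtain x :: 'a where "UNIV = {x}" by (rule card_1_singletonE)
  then have "(0 :: 'a) = 1" by (metis UNIV_I singletonD)
  then show False by simp
qed

lemma CHAR_F: "CHAR('a) = 2"
proof -
  have "(\<Sum>y\<in>(UNIV :: 'a set). y + 1) = (\<Sum>y\<in>UNIV. y)"
    by (rule sum.reindex_bij_witness[of _ "\<lambda>y. y - 1" "\<lambda>y. y + 1"]) auto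
  then have "of_nat CARD('a) = (0 :: 'a)" by (simp add: sum.distrib)
  then have "CHAR('a) dvd 2 ^ m" using card_F by (metis of_nat_eq_0_iff_char_dvd)
  moreover have "prime CHAR('a)"
    by (rule prime_CHAR_semidom) (rule finite_imp_CHAR_pos, simp)
  ultimately show ?thesis
    by (metis prime_dvd_power primes_dvd_imp_eq two_is_prime_nat)
qed

lemma add_self [simp]: "(x :: 'a) + x = 0"
proof -
  have "of_nat 2 = (0 :: 'a)" using CHAR_F by (metis of_nat_CHAR)
  then have "(1 :: 'a) + 1 = 0" by simp
  then have "x * (1 + 1) = 0" by simp
  then show ?thesis by (simp add: algebra_simps)
qed

lemma add_self_left [simp]: "(x :: 'a) + (x + y) = y"
  by (simp flip: add.assoc)

lemma add_eq_0_iff_eq: "(x :: 'a) + y = 0 \<longleftrightarrow> x = y"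
  by (metis add_self add_self_left add.right_neutral)

lemma frob_add: "((x :: 'a) + y) ^ (2 ^ j) = x ^ (2 ^ j) + y ^ (2 ^ j)"
proof -
  have "prime CHAR('a)" by (simp add: CHAR_F)
  then show ?thesis using freshmans_dream'[where x = x and y = y and n = j] by (simp add: CHAR_F)
qed

lemma frob_double: "(x :: 'a) ^ (2 ^ (2 * j)) = (x ^ (2 ^ j)) ^ (2 ^ j)"
  by (simp add: mult_2 power_add flip: power_mult)

lemma frob_card: "(x :: 'a) ^ (2 ^ m) = x"
  using finite_field_power_card_eq_same[of x] card_F by simp

lemma frob_eq_iff: "(x :: 'a) ^ (2 ^ j) = y ^ (2 ^ j) \<longleftrightarrow> x = y"
proof
  assume "x ^ (2 ^ j) = y ^ (2 ^ j)"
  then have "(x + y) ^ (2 ^ j) = 0" by (simp add: frob_add)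
  then show "x = y" by (simp add: add_eq_0_iff_eq)
qed simp

lemma bij_frob: "bij (\<lambda>x :: 'a. x ^ (2 ^ j))"
proof -
  have "inj (\<lambda>x :: 'a. x ^ (2 ^ j))" by (simp add: inj_def frob_eq_iff)
  then show ?thesis by (simp add: bij_def finite_UNIV_inj_surj)
qed

subsection \<open>The trace character\<close>

abbreviation tr :: "'a \<Rightarrow> bit" where
  "tr \<equiv> abs_trace m"

lemma of_bit_tr: "of_bit (tr x) = (\<Sum>i<m. x ^ (2 ^ i))"
  by (rule of_bit_abs_trace[OF card_F])

lemma of_bit_eq_iff: "(of_bit b :: 'a) = of_bit c \<longleftrightarrow> b = c"
  by (cases b; cases c) auto

lemma tr_add: "tr (x + y) = tr x + tr y"
proof -
  have "(of_bit (tr (x + y)) :: 'a) = of_bit (tr x) + of_bit (tr y)"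
    unfolding of_bit_tr by (simp add: frob_add sum.distrib)
  also have "\<dots> = of_bit (tr x + tr y)"
    by (cases "tr x"; cases "tr y") auto
  finally show ?thesis by (simp only: of_bit_eq_iff)
qed

lemma tr_0 [simp]: "tr 0 = 0"
  using tr_add[of 0 0] by (metis add_0 bit_add_self)

text \<open>Squaring shifts the power sum cyclically, because the exponent 2^m acts as the
  identity.\<close>

lemma tr_square: "tr (x ^ 2) = tr x"
proof -
  have "(of_bit (tr (x ^ 2)) :: 'a) = (\<Sum>i<m. x ^ (2 ^ Suc i))"
    unfolding of_bit_tr by (simp flip: power_mult)
  also have "\<dots> + x ^ (2 ^ 0) = (\<Sum>i<m. x ^ (2 ^ i)) + x ^ (2 ^ m)"
    using sum.lessThan_Suc_shift[of "\<lambda>i. x ^ (2 ^ i)" m] by (simp add: add.commute)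
  finally have "(of_bit (tr (x ^ 2)) :: 'a) = of_bit (tr x)"
    unfolding of_bit_tr by (simp add: frob_card)
  then show ?thesis by (simp only: of_bit_eq_iff)
qed

lemma tr_frob: "tr (x ^ (2 ^ j)) = tr x"
proof (induction j)
  case (Suc j)
  have "x ^ (2 ^ Suc j) = (x ^ (2 ^ j)) ^ 2" by (simp add: mult.commute flip: power_mult)
  then show ?case using Suc by (simp only: tr_square)
qed simp

lemma card_roots_le:
  fixes p :: "'a poly"
  assumes "p \<noteq> 0" "degree p \<le> d"
  shows "card {x. poly p x = 0} \<le> d"
  using card_poly_roots_bound[of p] assms by fastforce

text \<open>Otherwise the trace polynomial would vanish on all 2^m elements, although its degree is
  at most 2^(m-1) and its linear coefficient is 1.\<close>

lemma tr_surj: "\<exists>x. tr x = 1"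
proof (rule ccontr)
  assume "\<not> ?thesis"
  then have tr0: "tr x = 0" for x by (metis bit_neq_zero_iff)
  define p :: "'a poly" where "p = (\<Sum>i<m. monom 1 (2 ^ i))"
  have "poly p x = 0" for x
    using of_bit_tr[of x] tr0[of x] by (simp add: p_def poly_sum poly_monom)
  then have "card {x. poly p x = 0} = 2 ^ m" using card_F by simp
  moreover have "coeff p 1 = 1"
  proof -
    have "coeff p 1 = (\<Sum>i<m. if i = 0 then 1 else 0)"
      unfolding p_def coeff_sum by (rule sum.cong) auto
    then show ?thesis using m_pos by simp
  qed
  then have "p \<noteq> 0" by auto
  moreover have "degree p \<le> 2 ^ (m - 1)"
    unfolding p_def
  proof (rule degree_sum_le)
    fix i assume "i \<in> {..<m}"
    then have "(2::nat) ^ i \<le> 2 ^ (m - 1)" by (intro power_increasing) auto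
    then show "degree (monom (1::'a) (2 ^ i)) \<le> 2 ^ (m - 1)"
      using degree_monom_le[of "1::'a" "2 ^ i"] by linarith
  qed auto
  ultimately have "2 ^ m \<le> (2::nat) ^ (m - 1)" using card_roots_le by metis
  then show False using m_pos by simp
qed

lemma tr_nondegenerate: "(\<forall>x. tr (c * x) = 0) \<longleftrightarrow> c = 0"
proof
  assume *: "\<forall>x. tr (c * x) = 0"
  obtain y where y: "tr y = 1" using tr_surj by blast
  show "c = 0"
  proof (rule ccontr)
    assume "c \<noteq> 0"
    then show False using * y spec[OF *, of "y / c"] by simp
  qed
qed simp

definition psi :: "'a \<Rightarrow> real" where
  "psi x = bit_sign (tr x)"

lemma psi_add: "psi (x + y) = psi x * psi y"
  by (simp add: psi_def tr_add bit_sign_add)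

lemma psi_0 [simp]: "psi 0 = 1"
  by (simp add: psi_def)

lemma sum_psi: "(\<Sum>x\<in>UNIV. psi (c * x)) = (if c = 0 then 2 ^ m else 0)"
  unfolding psi_def
  by (subst sum_additive_character) (auto simp: distrib_left tr_add tr_nondegenerate card_F)

text \<open>Orthogonality in \<open>a\<close> and in \<open>b\<close> separately. Even powers of T
  expand into such sums, so its moments become numbers of solutions of a pair of equations.\<close>

lemma sum_psi_pair:
  assumes "finite I"
  shows "(\<Sum>(a, b)\<in>UNIV. \<Sum>i\<in>I. psi (a * A i + b * B i)) =
    (2 ^ m) ^ 2 * real (card {i \<in> I. A i = 0 \<and> B i = 0})"
proof -
  have "(\<Sum>(a, b)\<in>UNIV. \<Sum>i\<in>I. psi (a * A i + b * B i)) =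
      (\<Sum>i\<in>I. \<Sum>(a, b)\<in>UNIV. psi (a * A i + b * B i))"
    by (subst sum.swap) (simp add: case_prod_unfold)
  also have "\<dots> = (\<Sum>i\<in>I. (\<Sum>a\<in>UNIV. psi (A i * a)) * (\<Sum>b\<in>UNIV. psi (B i * b)))"
    by (simp add: sum_product sum.cartesian_product psi_add mult.commute flip: UNIV_Times_UNIV)
  also have "\<dots> = (\<Sum>i\<in>I. if A i = 0 \<and> B i = 0 then (2 ^ m) ^ 2 else 0)"
    by (rule sum.cong) (auto simp: sum_psi power2_eq_square)
  also have "\<dots> = (2 ^ m) ^ 2 * real (card {i \<in> I. A i = 0 \<and> B i = 0})"
    using assms by (simp add: sum.If_cases Int_def)
  finally show ?thesis .
qed

text \<open>Zero has trace 0 and is thereby excluded.\<close>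

definition D1 :: "'a set" where
  "D1 = {x. tr x = 1}"

lemma tr_cases: "tr x = 0 \<or> tr x = 1"
  by (metis bit_neq_zero_iff)

text \<open>The product of \<open>1 + psi u\<close> and \<open>1 + psi (u * s)\<close> is 4 times
  the indicator of the set. Expanding it gives character sums with coefficients 0, 1, s and 1 + s;
  the values 0 and 1 of s, where one condition is void or both coincide, contribute an extra
  sum.\<close>

lemma card_tr_0_pair:
  "real (card {u. tr u = 0 \<and> tr (u * s) = 0}) =
     (2 ^ m + (if s = 0 then 2 ^ m else 0) + (if s = 1 then 2 ^ m else 0)) / 4"
proof -
  have "(\<Sum>u\<in>UNIV. (1 + psi u) * (1 + psi (u * s))) =
      (\<Sum>u\<in>UNIV. if tr u = 0 \<and> tr (u * s) = 0 then 4 else 0)"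
    by (rule sum.cong) (use tr_cases in \<open>fastforce simp: psi_def\<close>)+
  also have "\<dots> = 4 * real (card {u. tr u = 0 \<and> tr (u * s) = 0})"
    by (simp add: sum.If_cases)
  finally have 1: "4 * real (card {u. tr u = 0 \<and> tr (u * s) = 0}) =
      (\<Sum>u\<in>UNIV. (1 + psi u) * (1 + psi (u * s)))" ..
  have "(1 + psi u) * (1 + psi (u * s)) = psi (0 * u) + psi (1 * u) + psi (s * u) + psi ((1 + s) * u)" for u
    by (simp add: algebra_simps psi_add)
  then have "(\<Sum>u\<in>UNIV. (1 + psi u) * (1 + psi (u * s))) =
     (\<Sum>u\<in>UNIV. psi (0 * u)) + (\<Sum>u\<in>UNIV. psi (1 * u)) + (\<Sum>u\<in>UNIV. psi (s * u)) + (\<Sum>u\<in>UNIV. psi ((1 + s) * u))"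
    by (simp only: sum.distrib)
  also have "\<dots> = 2 ^ m + (if s = 0 then 2 ^ m else 0) + (if s = 1 then 2 ^ m else 0)"
    using add_eq_0_iff_eq[of 1 s] by (simp only: sum_psi) auto
  finally show ?thesis using 1 by simp
qed

lemma card_tr_0: "real (card {u. tr u = 0}) = 2 ^ m / 2"
  using card_tr_0_pair[of 0] by simp

lemma real_card_D1: "real (card D1) = 2 ^ m / 2"
proof -
  have "card (D1 \<union> {u. tr u = 0}) = card D1 + card {u. tr u = 0}"
    by (rule card_Un_disjoint) (auto simp: D1_def)
  moreover have "D1 \<union> {u. tr u = 0} = UNIV" using tr_cases by (auto simp: D1_def)
  ultimately have "real (2 ^ m) = real (card D1) + real (card {u. tr u = 0})"
    using card_F by simp
  then show ?thesis using card_tr_0 by simp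
qed

lemma card_D1: "card D1 = 2 ^ (m - 1)"
proof -
  have "real (card D1) = real (2 ^ (m - 1))"
    unfolding real_card_D1 using power_minus_mult[OF m_pos, of "2::real"] by simp
  then show ?thesis by (simp only: of_nat_eq_iff)
qed

subsection \<open>Subfields\<close>

text \<open>The fixed field of a power of the Frobenius map, that is, a subfield in equational
  form.\<close>

definition frob_fixed :: "nat \<Rightarrow> 'a set" where
  "frob_fixed j = {x. x ^ (2 ^ j) = x}"

lemma frob_fixed_mult:
  assumes "(x :: 'a) ^ (2 ^ j) = x"
  shows "x ^ (2 ^ (j * n)) = x"
proof (induction n)
  case (Suc n)
  have "x ^ (2 ^ (j * Suc n)) = (x ^ (2 ^ (j * n))) ^ (2 ^ j)"
    by (simp add: power_add mult.commute flip: power_mult)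
  then show ?case using Suc assms by simp
qed simp

lemma frob_fixed_gcd: "frob_fixed j = frob_fixed (gcd j m)"
proof (intro equalityI subsetI)
  fix x :: 'a assume "x \<in> frob_fixed (gcd j m)"
  then have x: "x ^ (2 ^ gcd j m) = x" by (simp add: frob_fixed_def)
  obtain n where "j = gcd j m * n" by (meson dvdE gcd_dvd1)
  then show "x \<in> frob_fixed j" using frob_fixed_mult[OF x, of n] by (simp add: frob_fixed_def)
next
  fix x :: 'a assume "x \<in> frob_fixed j"
  then have x: "x ^ (2 ^ j) = x" by (simp add: frob_fixed_def)
  show "x \<in> frob_fixed (gcd j m)"
  \<comment> \<open>Bezout's identity over the natural numbers requires a nonzero \<open>j\<close>;
    for \<open>j = 0\<close> the gcd is \<open>m\<close>.\<close>
  proof (cases "j = 0")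
    case True
    then show ?thesis by (simp add: frob_fixed_def frob_card)
  next
    case False
    then obtain s t where st: "j * s = m * t + gcd j m" using bezout_nat by blast
    have "x = x ^ (2 ^ (j * s))" using frob_fixed_mult[OF x] by simp
    also have "\<dots> = (x ^ (2 ^ (m * t))) ^ (2 ^ gcd j m)"
      by (simp add: st power_add power_mult)
    also have "x ^ (2 ^ (m * t)) = x" by (rule frob_fixed_mult[OF frob_card])
    finally show ?thesis by (simp add: frob_fixed_def)
  qed
qed

text \<open>
  With \<open>N = 2 ^ g - 1\<close> and \<open>2 ^ m - 1 = N * M\<close>, every element is fixed by the
  \<open>g\<close>-th Frobenius power or is a root of \<open>\<Sum>i<M. X ^ (N * i)\<close>, which has degree \<open>2 ^ m - 2 ^ g\<close>.
\<close>

lemma card_frob_fixed_dvd: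
  assumes g: "g dvd m"
  shows "card (frob_fixed g) = 2 ^ g"
proof (rule antisym)
  have g0: "g > 0" using g m_pos by (rule dvd_pos_nat[rotated])
  then have g1: "(1::nat) < 2 ^ g" by (intro one_less_power) auto
  define p :: "'a poly" where "p = monom 1 (2 ^ g) - monom 1 1"
  have "coeff p (2 ^ g) = 1" using g1 by (simp add: p_def)
  then have p0: "p \<noteq> 0" by auto
  have "degree p \<le> 2 ^ g"
    unfolding p_def using g1
    by (intro degree_diff_le order.trans[OF degree_monom_le]) auto
  then have "card {x. poly p x = 0} \<le> 2 ^ g" by (rule card_roots_le[OF p0])
  moreover have "{x. poly p x = 0} = frob_fixed g"
    by (auto simp: p_def frob_fixed_def poly_monom)
  ultimately show "card (frob_fixed g) \<le> 2 ^ g" by simp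
next
  have g0: "g > 0" using g m_pos by (rule dvd_pos_nat[rotated])
  then have g1: "(1::nat) < 2 ^ g" by (intro one_less_power) auto
  obtain n where n: "m = g * n" using g by (rule dvdE)
  define N :: nat where "N = 2 ^ g - 1"
  have N0: "N > 0" using g1 by (simp add: N_def)
  \<comment> \<open>The divisibility of 2^m - 1 by 2^g - 1, phrased without subtraction.\<close>
  have "\<exists>M. (N + 1) ^ n = N * M + 1"
  proof (induction n)
    case (Suc n)
    then obtain M where "(N + 1) ^ n = N * M + 1" by blast
    then have "(N + 1) ^ Suc n = N * (N * M + M + 1) + 1" by (simp add: algebra_simps)
    then show ?case by blast
  qed auto
  moreover have "(N + 1) ^ n = 2 ^ m" using g1 by (simp add: N_def n power_mult)
  ultimately obtain M where M': "2 ^ m = N * M + 1" by metis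
  then have M: "2 ^ m - 1 = N * M" by simp
  have M0: "M > 0" using M one_less_power[of "2::nat" m] m_pos by (cases M) auto
  define h :: "'a poly" where "h = (\<Sum>i<M. monom 1 (N * i))"
  have "coeff h 0 = 1"
  proof -
    have "coeff h 0 = (\<Sum>i<M. if i = 0 then 1 else 0)"
      unfolding h_def coeff_sum by (rule sum.cong) (use N0 in auto)
    then show ?thesis using M0 by simp
  qed
  then have h0: "h \<noteq> 0" by auto
  have "degree h \<le> N * (M - 1)"
    unfolding h_def
    by (rule degree_sum_le) (auto intro!: order.trans[OF degree_monom_le])
  then have roots: "card {x. poly h x = 0} \<le> N * (M - 1)" by (rule card_roots_le[OF h0])
  have "UNIV \<subseteq> frob_fixed g \<union> {x. poly h x = 0}"
  proof
    fix x :: 'a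
    show "x \<in> frob_fixed g \<union> {x. poly h x = 0}"
    proof (cases "x = 0")
      case True
      then show ?thesis by (simp add: frob_fixed_def)
    next
      case False
      have "x * x ^ (2 ^ m - 1) = x * 1"
        using frob_card[of x] by (simp flip: power_Suc)
      then have "x ^ (N * M) = 1" using False by (simp only: M mult_cancel_left) simp
      then have "(x ^ N - 1) * (\<Sum>i<M. (x ^ N) ^ i) = 0"
        using power_diff_1_eq[of "x ^ N" M] by (simp add: power_mult)
      moreover have "poly h x = (\<Sum>i<M. (x ^ N) ^ i)"
        by (simp add: h_def poly_sum poly_monom power_mult)
      moreover have "x ^ (2 ^ g) = x * x ^ N"
        using g1 by (simp add: N_def flip: power_Suc)
      ultimately show ?thesis by (auto simp: frob_fixed_def)
    qed
  qed
  then have "card (UNIV :: 'a set) \<le> card (frob_fixed g \<union> {x. poly h x = 0})"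
    by (intro card_mono) auto
  also have "\<dots> \<le> card (frob_fixed g) + card {x. poly h x = 0}" by (rule card_Un_le)
  finally have "2 ^ m \<le> card (frob_fixed g) + N * (M - 1)" using roots card_F by simp
  moreover have "N * (M - 1) + 2 ^ g = 2 ^ m"
  proof -
    have "N * (M - 1) + N = N * M" using M0 by (cases M) auto
    moreover have "N + 1 = 2 ^ g" "N * M + 1 = 2 ^ m" using g1 M' by (simp_all add: N_def)
    ultimately show ?thesis by linarith
  qed
  ultimately show "2 ^ g \<le> card (frob_fixed g)" by linarith
qed

lemma card_frob_fixed: "card (frob_fixed j) = 2 ^ gcd j m"
  using card_frob_fixed_dvd[of "gcd j m"] frob_fixed_gcd[of j] by simp

end

subsection \<open>The Gold function\<close>

locale gold_function = binary_field F m for F :: "'a::finite_field itself" and m +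
  fixes k :: nat
begin

definition gold :: "'a \<Rightarrow> 'a" where
  "gold x = x ^ (2 ^ k + 1)"

text \<open>The biadditive map associated with the quadratic map \<open>gold\<close>.\<close>

definition polar :: "'a \<Rightarrow> 'a \<Rightarrow> 'a" where
  "polar x y = x ^ (2 ^ k) * y + x * y ^ (2 ^ k)"

lemma gold_add: "gold (x + y) = gold x + gold y + polar x y"
proof -
  have "gold z = z ^ (2 ^ k) * z" for z by (simp add: gold_def mult.commute)
  then show ?thesis by (simp add: frob_add polar_def algebra_simps)
qed

lemma polar_add_left: "polar (x + y) z = polar x z + polar y z"
  by (simp add: polar_def frob_add algebra_simps)

text \<open>The second difference of a quadratic map does not depend on the base point. Hence both
  the fourth moment and the dual words of weight 4 are governed by the differences \<open>u\<close>
  and \<open>v\<close> alone.\<close>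

lemma gold_four: "gold x + gold (x + u) + (gold (x + v) + gold (x + u + v)) = polar u v"
proof -
  have "gold (x + u + v) = gold x + gold u + polar x u + gold v + (polar x v + polar u v)"
    by (simp only: gold_add[of "x + u"] gold_add[of x] polar_add_left)
  then show ?thesis by (simp only: gold_add[of x]) (simp add: ac_simps)
qed

lemma gold_0 [simp]: "gold 0 = 0"
  by (simp add: gold_def)

section \<open>Quadratic forms, their radicals and their exponential sums\<close>

definition quad :: "'a \<Rightarrow> 'a \<Rightarrow> 'a \<Rightarrow> 'a" where
  "quad a b x = a * gold x + b * x"

lemma quad_add: "quad a b (x + y) = quad a b x + quad a b y + a * polar x y"
  by (simp add: quad_def gold_add algebra_simps)

definition radical :: "'a \<Rightarrow> 'a set" where
  "radical a = {u. a ^ (2 ^ k) * u ^ (2 ^ (2 * k)) = a * u}"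

text \<open>Raising one summand to the power 2^k preserves its trace and brings \<open>x\<close> to
  the same power in both terms. Since this power runs through the whole field, the form vanishes for
  all \<open>x\<close> exactly when \<open>u\<close> lies in \<open>radical a\<close>.\<close>

lemma tr_polar:
  "tr (a * polar x u) = tr ((a * u + a ^ (2 ^ k) * u ^ (2 ^ (2 * k))) * x ^ (2 ^ k))"
proof -
  have "tr (a * x * u ^ (2 ^ k)) = tr (a ^ (2 ^ k) * x ^ (2 ^ k) * u ^ (2 ^ (2 * k)))"
    using tr_frob[of "a * x * u ^ (2 ^ k)" k] by (simp only: power_mult_distrib frob_double)
  then show ?thesis
    by (simp add: polar_def distrib_left distrib_right tr_add mult_ac)
qed

lemma tr_polar_radical: "u \<in> radical a \<Longrightarrow> tr (a * polar x u) = 0"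
  unfolding tr_polar by (simp add: radical_def)

definition weil_sum :: "'a \<Rightarrow> 'a \<Rightarrow> real" where
  "weil_sum a b = (\<Sum>x\<in>UNIV. psi (quad a b x))"

lemma radical_add: "u \<in> radical a \<Longrightarrow> v \<in> radical a \<Longrightarrow> u + v \<in> radical a"
  by (simp add: radical_def frob_add distrib_left)

text \<open>Squaring with the substitution y = x + u makes the inner sum over x a linear character
  sum, which kills every u outside the radical. On the radical the quadratic form is additive, so
  orthogonality applies a second time.\<close>

lemma weil_sum_square:
  "(weil_sum a b)\<^sup>2 = (if \<forall>u\<in>radical a. tr (quad a b u) = 0 then 2 ^ m * real (card (radical a)) else 0)"
proof -
  have shift: "(\<Sum>y\<in>UNIV. psi (quad a b y)) = (\<Sum>u\<in>UNIV. psi (quad a b (x + u)))" for x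
    by (rule sum.reindex_bij_witness[of _ "\<lambda>u. x + u" "\<lambda>y. y - x"]) auto
  have "(weil_sum a b)\<^sup>2 = (\<Sum>x\<in>UNIV. psi (quad a b x) * (\<Sum>u\<in>UNIV. psi (quad a b (x + u))))"
    unfolding power2_eq_square weil_sum_def
    by (subst sum_distrib_right) (simp only: shift[symmetric])
  also have "\<dots> = (\<Sum>x\<in>UNIV. \<Sum>u\<in>UNIV. psi (quad a b u) * psi (a * polar x u))"
  proof -
    have "psi (quad a b x) * psi (quad a b (x + u)) = psi (quad a b u) * psi (a * polar x u)" for x u
      by (simp only: quad_add add.assoc add_self_left flip: psi_add)
    then show ?thesis by (simp add: sum_distrib_left)
  qed
  also have "\<dots> = (\<Sum>u\<in>UNIV. psi (quad a b u) * (\<Sum>x\<in>UNIV. psi (a * polar x u)))"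
    by (subst sum.swap) (simp add: sum_distrib_left)
  also have "\<dots> = (\<Sum>u\<in>UNIV. if u \<in> radical a then 2 ^ m * psi (quad a b u) else 0)"
  proof (rule sum.cong)
    fix u
    let ?c = "a * u + a ^ (2 ^ k) * u ^ (2 ^ (2 * k))"
    have "(\<Sum>x\<in>UNIV. psi (a * polar x u)) = (\<Sum>x\<in>UNIV. psi (?c * x ^ (2 ^ k)))"
      by (simp only: psi_def tr_polar)
    also have "\<dots> = (\<Sum>x\<in>UNIV. psi (?c * x))"
      using sum.reindex_bij_betw[OF bij_frob[of k], of "\<lambda>x. psi (?c * x)"] .
    also have "\<dots> = (if u \<in> radical a then 2 ^ m else 0)"
      unfolding sum_psi radical_def mem_Collect_eq add_eq_0_iff_eq by auto
    finally show "psi (quad a b u) * (\<Sum>x\<in>UNIV. psi (a * polar x u)) =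
        (if u \<in> radical a then 2 ^ m * psi (quad a b u) else 0)" by simp
  qed auto
  also have "\<dots> = 2 ^ m * (\<Sum>u\<in>radical a. psi (quad a b u))"
    by (simp add: sum.If_cases sum_distrib_left)
  also have "(\<Sum>u\<in>radical a. psi (quad a b u)) =
      (if \<forall>u\<in>radical a. tr (quad a b u) = 0 then real (card (radical a)) else 0)"
    unfolding psi_def
  proof (rule sum_additive_character)
    fix u v assume "u \<in> radical a" "v \<in> radical a"
    then show "u + v \<in> radical a" "tr (quad a b (u + v)) = tr (quad a b u) + tr (quad a b v)"
      by (simp_all only: radical_add quad_add tr_add tr_polar_radical add_0_right)
  qed simp
  finally show ?thesis by simp
qed

lemma zero_in_radical: "0 \<in> radical a"
  by (simp add: radical_def)

text \<open>The quotient of two radical elements satisfies an equation free of \<open>a\<close>,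
  namely that of \<open>frob_fixed (2 * k)\<close>; the radical is thus a multiple of that
  subfield.\<close>

lemma card_radical:
  assumes "w \<in> radical a" "w \<noteq> 0" "a \<noteq> 0"
  shows "card (radical a) = 2 ^ gcd (2 * k) m"
proof -
  have w: "a ^ (2 ^ k) * w ^ (2 ^ (2 * k)) = a * w" using assms by (simp add: radical_def)
  have mem: "w * s \<in> radical a \<longleftrightarrow> s \<in> frob_fixed (2 * k)" for s
  proof -
    have "a ^ (2 ^ k) * (w * s) ^ (2 ^ (2 * k)) = a * w * s ^ (2 ^ (2 * k))"
      by (simp add: power_mult_distrib flip: w)
    then show ?thesis using assms(2,3) by (simp add: radical_def frob_fixed_def)
  qed
  have "bij_betw (\<lambda>s. w * s) (frob_fixed (2 * k)) (radical a)"
  proof (rule bij_betw_byWitness[where f' = "\<lambda>u. u / w"])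
    show "(\<lambda>u. u / w) ` radical a \<subseteq> frob_fixed (2 * k)"
    proof (rule image_subsetI)
      fix u assume "u \<in> radical a"
      then show "u / w \<in> frob_fixed (2 * k)" using mem[of "u / w"] assms(2) by simp
    qed
  qed (use assms(2) mem in \<open>auto simp: image_subset_iff\<close>)
  then show ?thesis using card_frob_fixed[of "2 * k"] by (simp add: bij_betw_same_card)
qed

section \<open>Exponential sums over the points of trace 1\<close>

definition trace_sum :: "'a \<Rightarrow> 'a \<Rightarrow> real" where
  "trace_sum a b = (\<Sum>x\<in>D1. psi (quad a b x))"

lemma quad_add_one: "quad a (b + 1) x = quad a b x + x"
  by (simp add: quad_def algebra_simps)

text \<open>The factor \<open>1 - psi x\<close> is twice the indicator of trace 1, and
  multiplication by \<open>psi x\<close> is the passage from \<open>b\<close> to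
  \<open>b + 1\<close>.\<close>

lemma trace_sum_weil_sum: "2 * trace_sum a b = weil_sum a b - weil_sum a (b + 1)"
proof -
  have "weil_sum a b - weil_sum a (b + 1) = (\<Sum>x\<in>UNIV. psi (quad a b x) * (1 - psi x))"
    by (simp add: weil_sum_def quad_add_one psi_add right_diff_distrib sum_subtractf)
  also have "\<dots> = (\<Sum>x\<in>UNIV. if x \<in> D1 then 2 * psi (quad a b x) else 0)"
  proof (rule sum.cong)
    fix x
    show "psi (quad a b x) * (1 - psi x) = (if x \<in> D1 then 2 * psi (quad a b x) else 0)"
      using tr_cases[of x] by (auto simp: D1_def psi_def)
  qed simp
  also have "\<dots> = 2 * trace_sum a b"
    by (simp add: sum.If_cases trace_sum_def sum_distrib_left)
  finally show ?thesis ..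
qed

text \<open>On \<open>D1\<close> the extra term \<open>x\<close> has trace 1, so the codeword is
  complemented.\<close>

lemma trace_sum_add_one: "trace_sum a (b + 1) = - trace_sum a b"
proof -
  have "psi x = - 1" if "x \<in> D1" for x
    using that by (simp add: D1_def psi_def)
  then show ?thesis
    unfolding trace_sum_def sum_negf[symmetric]
    by (intro sum.cong) (simp_all add: quad_add_one psi_add)
qed

lemma trace_sum_zero_left:
  "trace_sum 0 b = (if b = 0 then 2 ^ m / 2 else if b = 1 then - (2 ^ m / 2) else 0)"
proof -
  have "weil_sum 0 b = (if b = 0 then 2 ^ m else 0)" for b
    unfolding weil_sum_def quad_def using sum_psi[of b] by simp
  then show ?thesis
    using trace_sum_weil_sum[of 0 b] add_eq_0_iff_eq[of b 1] by (auto split: if_splits)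
qed

lemma trace_sum_values:
  assumes r: "2 ^ m * real (card (radical a)) = (2 * A)\<^sup>2"
  shows "trace_sum a b \<in> {0, A, - A, 2 * A, - (2 * A)}"
proof -
  have "(weil_sum a b)\<^sup>2 = (2 * A)\<^sup>2 \<or> (weil_sum a b)\<^sup>2 = 0" for b
    using weil_sum_square[of a b] r by auto
  then have "weil_sum a b \<in> {0, 2 * A, - (2 * A)}" for b
    unfolding power2_eq_iff by (metis insertCI zero_eq_power2)
  from this[of b] this[of "b + 1"] show ?thesis
    using trace_sum_weil_sum[of a b] by auto
qed

text \<open>With a trivial radical the full sum never vanishes, so half the difference of two values
  +-A is 0 or +-A; the values +-2A do not arise.\<close>

lemma trace_sum_values_trivial_radical:
  assumes r: "radical a = {0}" and A: "2 ^ m = A\<^sup>2"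
  shows "trace_sum a b \<in> {0, A, - A}"
proof -
  have "(weil_sum a b)\<^sup>2 = A\<^sup>2" for b
    using weil_sum_square[of a b] r A by (simp add: quad_def)
  then have "weil_sum a b \<in> {A, - A}" for b
    unfolding power2_eq_iff by simp
  from this[of b] this[of "b + 1"] show ?thesis
    using trace_sum_weil_sum[of a b] by auto
qed

subsection \<open>Power moments\<close>

lemma trace_sum_square:
  "(trace_sum a b)\<^sup>2 = (\<Sum>(x, y)\<in>D1 \<times> D1. psi (a * (gold x + gold y) + b * (x + y)))"
proof -
  have "(trace_sum a b)\<^sup>2 = (\<Sum>(x, y)\<in>D1 \<times> D1. psi (quad a b x) * psi (quad a b y))"
    unfolding power2_eq_square trace_sum_def by (simp add: sum_product sum.cartesian_product)
  also have "\<dots> = (\<Sum>(x, y)\<in>D1 \<times> D1. psi (a * (gold x + gold y) + b * (x + y)))"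
    by (rule sum.cong) (auto simp: quad_def algebra_simps simp flip: psi_add)
  finally show ?thesis .
qed

text \<open>The linear equation x + y = 0 already forces x = y, so only the diagonal of
  \<open>D1 \<times> D1\<close> is counted.\<close>

lemma second_moment: "(\<Sum>(a, b)\<in>UNIV. (trace_sum a b)\<^sup>2) = (2 ^ m) ^ 2 * (2 ^ m / 2)"
proof -
  have "(\<Sum>(a, b)\<in>UNIV. (trace_sum a b)\<^sup>2) = (2 ^ m) ^ 2 *
      real (card {i \<in> D1 \<times> D1. (case i of (x, y) \<Rightarrow> gold x + gold y) = 0 \<and> (case i of (x, y) \<Rightarrow> x + y) = 0})"
    unfolding trace_sum_square using sum_psi_pair[of "D1 \<times> D1" "\<lambda>(x, y). gold x + gold y" "\<lambda>(x, y). x + y"]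
    by (simp add: case_prod_unfold)
  also have "{i \<in> D1 \<times> D1. (case i of (x, y) \<Rightarrow> gold x + gold y) = 0 \<and> (case i of (x, y) \<Rightarrow> x + y) = 0} =
      (\<lambda>x. (x, x)) ` D1"
    by (auto simp: add_eq_0_iff_eq)
  also have "card \<dots> = card D1" by (rule card_image) (simp add: inj_on_def)
  also have "real (card D1) = 2 ^ m / 2" by (rule real_card_D1)
  finally show ?thesis .
qed

lemma polar_eq_0_iff:
  assumes "u \<noteq> 0"
  shows "polar u v = 0 \<longleftrightarrow> v / u \<in> frob_fixed k"
proof -
  have "polar u v = 0 \<longleftrightarrow> u ^ (2 ^ k) * v = u * v ^ (2 ^ k)"
    by (simp add: polar_def add_eq_0_iff_eq)
  also have "\<dots> \<longleftrightarrow> v / u \<in> frob_fixed k"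
    using assms by (auto simp: frob_fixed_def power_divide field_simps)
  finally show ?thesis .
qed

text \<open>The pairs with u = 0 are parametrised by v, the others by u and the ratio s = v/u, which
  runs through the subfield. For each s the count is that of two trace conditions on u, with u = 0
  taken away.\<close>

lemma card_polar_zero:
  "real (card {(u, v). tr u = 0 \<and> tr v = 0 \<and> polar u v = 0}) =
     2 ^ m + 2 ^ m * 2 ^ gcd k m / 4 - 2 ^ gcd k m"
proof -
  let ?K = "frob_fixed k" and ?H = "{u. tr u = 0}"
  let ?P1 = "Pair (0 :: 'a) ` ?H" and ?E = "\<lambda>s. {u. tr u = 0 \<and> tr (u * s) = 0} - {0}"
  let ?P2 = "(\<lambda>(s, u). (u, u * s)) ` Sigma ?K ?E"
  have K01: "0 \<in> ?K" "1 \<in> ?K" by (auto simp: frob_fixed_def)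
  have cK: "card ?K = 2 ^ gcd k m" by (rule card_frob_fixed)
  have "{(u, v). tr u = 0 \<and> tr v = 0 \<and> polar u v = 0} = ?P1 \<union> ?P2"
  proof (intro equalityI subsetI)
    fix p assume p: "p \<in> {(u, v). tr u = 0 \<and> tr v = 0 \<and> polar u v = 0}"
    obtain u v where uv: "p = (u, v)" by (cases p)
    show "p \<in> ?P1 \<union> ?P2"
    proof (cases "u = 0")
      case True
      then show ?thesis using p uv by auto
    next
      case False
      then have "p = (\<lambda>(s, u). (u, u * s)) (v / u, u)" "(v / u, u) \<in> Sigma ?K ?E"
        using p uv by (auto simp: polar_eq_0_iff)
      then show ?thesis by blast
    qed
  next
    fix p assume "p \<in> ?P1 \<union> ?P2"
    then show "p \<in> {(u, v). tr u = 0 \<and> tr v = 0 \<and> polar u v = 0}"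
      by (auto simp: polar_eq_0_iff) (simp add: polar_def)
  qed
  moreover have "card (?P1 \<union> ?P2) = card ?P1 + card ?P2"
    by (rule card_Un_disjoint) (simp, simp, auto)
  moreover have "card ?P1 = card ?H" by (rule card_image) (simp add: inj_on_def)
  moreover have "card ?P2 = card (Sigma ?K ?E)" by (rule card_image) (auto simp: inj_on_def)
  moreover have "card (Sigma ?K ?E) = (\<Sum>s\<in>?K. card (?E s))" by (rule card_SigmaI) auto
  ultimately have "real (card {(u, v). tr u = 0 \<and> tr v = 0 \<and> polar u v = 0}) =
      real (card ?H) + (\<Sum>s\<in>?K. real (card (?E s)))"
    by simp
  also have "(\<Sum>s\<in>?K. real (card (?E s))) =
      (\<Sum>s\<in>?K. (2 ^ m + (if s = 0 then 2 ^ m else 0) + (if s = 1 then 2 ^ m else 0)) / 4 - 1)"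
  proof (rule sum.cong)
    fix s
    have "0 < card {u. tr u = 0 \<and> tr (u * s) = 0}" by (subst card_gt_0_iff) (auto intro: exI[of _ 0])
    then have "real (card (?E s)) = real (card {u. tr u = 0 \<and> tr (u * s) = 0}) - 1"
      by (subst card_Diff_singleton) auto
    then show "real (card (?E s)) =
        (2 ^ m + (if s = 0 then 2 ^ m else 0) + (if s = 1 then 2 ^ m else 0)) / 4 - 1"
      by (simp only: card_tr_0_pair)
  qed simp
  also have "\<dots> = (2 ^ m * 2 ^ gcd k m + 2 ^ m + 2 ^ m) / 4 - 2 ^ gcd k m"
    using K01 by (simp add: sum_subtractf sum.distrib cK flip: sum_divide_distrib)
  finally show ?thesis by (simp add: card_tr_0 field_simps)
qed

text \<open>The linear equation determines w, and the differences u = x + y, v = x + z replace y and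
  z. Membership in \<open>D1\<close> becomes trace 0 for u and v, and the equation for
  \<open>gold\<close> becomes \<open>polar u v = 0\<close>, so x ranges freely over
  \<open>D1\<close>.\<close>

lemma fourth_moment:
  "(\<Sum>(a, b)\<in>UNIV. (trace_sum a b) ^ 4) =
     (2 ^ m) ^ 2 * (2 ^ m / 2 * (2 ^ m + 2 ^ m * 2 ^ gcd k m / 4 - 2 ^ gcd k m))"
proof -
  let ?A = "\<lambda>((x, y), (z, w)). gold x + gold y + (gold z + gold w)"
  let ?B = "\<lambda>((x, y), (z, w)). x + y + (z + w) :: 'a"
  let ?I = "(D1 \<times> D1) \<times> (D1 \<times> D1)"
  let ?P = "{(u, v). tr u = 0 \<and> tr v = 0 \<and> polar u v = 0}"
  let ?f = "\<lambda>((x :: 'a, y), (z, w :: 'a)). (x, (x + y, x + z))"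
  let ?g = "\<lambda>(x :: 'a, (u, v)). ((x, x + u), (x + v, x + u + v))"
  have "(trace_sum a b) ^ 4 = (\<Sum>i\<in>?I. psi (a * ?A i + b * ?B i))" for a b
  proof -
    have "(trace_sum a b) ^ 4 = (trace_sum a b)\<^sup>2 * (trace_sum a b)\<^sup>2" by simp
    also have "\<dots> = (\<Sum>p\<in>D1 \<times> D1. \<Sum>q\<in>D1 \<times> D1.
        psi (a * (gold (fst p) + gold (snd p)) + b * (fst p + snd p)) *
        psi (a * (gold (fst q) + gold (snd q)) + b * (fst q + snd q)))"
      unfolding trace_sum_square sum_product by (simp add: case_prod_unfold)
    also have "\<dots> = (\<Sum>(p, q)\<in>?I.
        psi (a * (gold (fst p) + gold (snd p)) + b * (fst p + snd p)) *
        psi (a * (gold (fst q) + gold (snd q)) + b * (fst q + snd q)))"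
      by (rule sum.cartesian_product)
    also have "\<dots> = (\<Sum>i\<in>?I. psi (a * ?A i + b * ?B i))"
      by (rule sum.cong) (auto simp: algebra_simps simp flip: psi_add)
    finally show ?thesis .
  qed
  then have "(\<Sum>(a, b)\<in>UNIV. (trace_sum a b) ^ 4) =
      (2 ^ m) ^ 2 * real (card {i \<in> ?I. ?A i = 0 \<and> ?B i = 0})"
    using sum_psi_pair[of ?I ?A ?B] by simp
  also have "card {i \<in> ?I. ?A i = 0 \<and> ?B i = 0} = card (D1 \<times> ?P)"
  proof (rule bij_betw_same_card[OF bij_betw_byWitness[
        where f = ?f and f' = ?g]])
    have w: "w = x + (x + y) + (x + z)" if "x + y + (z + w) = 0" for x y z w :: 'a
    proof -
      have "x + y + z = w" using that add_eq_0_iff_eq[of "x + y + z" w] by (simp add: ac_simps)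
      then show ?thesis by (simp add: ac_simps)
    qed
    have pol: "gold x + gold y + (gold z + gold (x + (x + y) + (x + z))) = polar (x + y) (x + z)" for x y z
      using gold_four[of x "x + y" "x + z"] by simp
    show "\<forall>i\<in>{i \<in> ?I. ?A i = 0 \<and> ?B i = 0}. ?g (?f i) = i"
      by (auto dest: w)
    show "\<forall>i\<in>D1 \<times> ?P. ?f (?g i) = i"
      by auto
    show "?f ` {i \<in> ?I. ?A i = 0 \<and> ?B i = 0} \<subseteq> D1 \<times> ?P"
    proof (clarsimp, intro conjI)
      fix x y z w
      assume *: "x \<in> D1" "y \<in> D1" "z \<in> D1" "w \<in> D1" "gold x + gold y + (gold z + gold w) = 0"
        "x + y + (z + w) = 0"
      show "tr (x + y) = 0" "tr (x + z) = 0" using * by (auto simp: D1_def tr_add)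
      show "polar (x + y) (x + z) = 0" using *(5) pol[of x y z] w[OF *(6)] by simp
    qed
    show "?g ` (D1 \<times> ?P) \<subseteq> {i \<in> ?I. ?A i = 0 \<and> ?B i = 0}"
    proof (rule image_subsetI)
      fix p assume "p \<in> D1 \<times> ?P"
      then obtain x u v where p: "p = (x, (u, v))"
        and *: "x \<in> D1" "tr u = 0" "tr v = 0" "polar u v = 0" by auto
      have "x + (x + u) + (x + v + (x + u + v)) = 0" by (simp add: ac_simps)
      moreover have "x + u \<in> D1" "x + v \<in> D1" "x + u + v \<in> D1"
        using * by (auto simp: D1_def tr_add)
      moreover have "gold x + gold (x + u) + (gold (x + v) + gold (x + u + v)) = 0"
        using gold_four[of x u v] *(4) by (simp only:)
      ultimately show "?g p \<in> {i \<in> ?I. ?A i = 0 \<and> ?B i = 0}"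
        unfolding p using *(1) by (simp only: mem_Collect_eq mem_Times_iff case_prod_conv fst_conv snd_conv simp_thms)
    qed
  qed
  also have "real (card (D1 \<times> ?P)) = real (card D1) * real (card ?P)"
    by (simp add: card_cartesian_product)
  also have "real (card D1) = 2 ^ m / 2" by (rule real_card_D1)
  also note card_polar_zero
  finally show ?thesis by simp
qed

end

subsection \<open>The punctured code\<close>

locale gold_code = gold_function F m k
  for F :: "'a::finite_field itself" and m k +
  fixes e :: "'n::finite \<Rightarrow> 'a"
  assumes bij_e: "bij_betw e UNIV D1"
begin

definition word :: "'a \<times> 'a \<Rightarrow> bit ^ 'n" where
  "word p = (\<chi> i. tr (quad (fst p) (snd p) (e i)))"

definition code :: "(bit ^ 'n) set" where
  "code = range word"

lemma punctured_code_eq: "punctured_code m (\<lambda>x. x ^ (2 ^ k + 1)) e = code"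
  by (auto simp: punctured_code_def code_def word_def quad_def gold_def image_def)

lemma card_n: "CARD('n) = 2 ^ (m - 1)"
  using bij_betw_same_card[OF bij_e] card_D1 by simp

lemma word_add: "word (p + q) = word p + word q"
proof -
  have "quad (fst (p + q)) (snd (p + q)) x = quad (fst p) (snd p) x + quad (fst q) (snd q) x" for x
    by (simp add: quad_def algebra_simps)
  then show ?thesis by (simp add: word_def vec_eq_iff tr_add)
qed

lemma subspace_code: "vec.subspace code"
proof (rule subspace_bitI)
  show "0 \<in> code" using word_add[of 0 0] by (metis add_0 bit_vec_add_self code_def rangeI)
  show "u + v \<in> code" if "u \<in> code" "v \<in> code" for u v
    using that by (auto simp: code_def simp flip: word_add)
qed

lemma trace_sum_weight:
  "trace_sum a b = 2 ^ m / 2 - 2 * real (hamming_weight (word (a, b)))"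
proof -
  have "hamming_weight (word (a, b)) = card {i. tr (quad a b (e i)) = 1}"
    by (simp add: hamming_weight_def word_def bit_neq_zero_iff)
  also have "\<dots> = card {x \<in> D1. tr (quad a b x) = 1}"
  proof (rule bij_betw_same_card)
    show "bij_betw e {i. tr (quad a b (e i)) = 1} {x \<in> D1. tr (quad a b x) = 1}"
      using bij_e unfolding bij_betw_def by (auto simp: inj_on_def)
  qed
  finally have w: "hamming_weight (word (a, b)) = card {x \<in> D1. tr (quad a b x) = 1}" .
  have "trace_sum a b = (\<Sum>x\<in>D1. 1 - (if tr (quad a b x) = 1 then 2 else 0))"
    unfolding trace_sum_def
  proof (rule sum.cong)
    fix x
    show "psi (quad a b x) = 1 - (if tr (quad a b x) = 1 then 2 else 0)"
      using tr_cases[of "quad a b x"] by (auto simp: psi_def)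
  qed simp
  also have "\<dots> = real (card D1) - 2 * real (card {x \<in> D1. tr (quad a b x) = 1})"
    by (simp add: sum_subtractf sum.If_cases Int_def)
  finally show ?thesis using w real_card_D1 by simp
qed

text \<open>Pairs are counted, not codewords; \<open>freq (2 ^ m / 2)\<close> is the number of pairs
  that give the zero word.\<close>

definition freq :: "real \<Rightarrow> real" where
  "freq v = real (card {(a, b). trace_sum a b = v})"

lemma freq_uminus: "freq (- v) = freq v"
proof -
  have "bij_betw (\<lambda>(a, b). (a, b + 1)) {(a, b). trace_sum a b = - v} {(a, b). trace_sum a b = v}"
    by (rule bij_betw_byWitness[where f' = "\<lambda>(a, b). (a, b + 1)"])
      (auto simp: trace_sum_add_one add.assoc)
  then show ?thesis by (simp add: freq_def bij_betw_same_card)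
qed

lemma sum_freq:
  assumes "finite V" "\<And>a b. trace_sum a b \<in> V"
  shows "(\<Sum>(a, b)\<in>UNIV. g (trace_sum a b)) = (\<Sum>v\<in>V. freq v * g v)"
proof -
  have "(\<Sum>p\<in>UNIV. g (case_prod trace_sum p)) =
      (\<Sum>v\<in>V. \<Sum>p\<in>{p \<in> UNIV. case_prod trace_sum p = v}. g (case_prod trace_sum p))"
    by (rule sum.group[symmetric]) (use assms in auto)
  also have "\<dots> = (\<Sum>v\<in>V. freq v * g v)"
    by (rule sum.cong) (auto simp: freq_def case_prod_unfold)
  finally show ?thesis by (simp add: case_prod_unfold)
qed

lemma card_weight_freq:
  "real (card {c \<in> code. hamming_weight c = w}) * freq (2 ^ m / 2) = freq (2 ^ m / 2 - 2 * real w)"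
proof -
  have "card {p. word p \<in> {c \<in> code. hamming_weight c = w}} =
      card {p. word p = 0} * card {c \<in> code. hamming_weight c = w}"
    by (rule card_additive_vimage) (auto simp: word_add code_def)
  moreover have "{p. word p \<in> {c \<in> code. hamming_weight c = w}} =
      {(a, b). trace_sum a b = 2 ^ m / 2 - 2 * real w}"
    by (auto simp: trace_sum_weight code_def)
  moreover have "{p. word p = 0} = {(a, b). trace_sum a b = 2 ^ m / 2}"
    by (auto simp: trace_sum_weight hamming_weight_supp supp_def vec_eq_iff)
  ultimately show ?thesis unfolding freq_def by (simp add: mult.commute)
qed

lemma freq_pos: "freq (2 ^ m / 2) > 0"
proof -
  have "(0, 0) \<in> {(a, b). trace_sum a b = 2 ^ m / 2}"
    by (simp add: trace_sum_zero_left)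
  then have "0 < card {(a, b). trace_sum a b = 2 ^ m / 2}"
    by (intro card_gt_0_iff[THEN iffD2] conjI finite) blast
  then show ?thesis by (simp add: freq_def)
qed

lemma card_code: "real (card code) * freq (2 ^ m / 2) = (2 ^ m) ^ 2"
proof -
  have "card {p. word p \<in> code} = card {p. word p = 0} * card code"
    by (rule card_additive_vimage) (auto simp: word_add code_def)
  moreover have "{p. word p \<in> code} = UNIV \<times> UNIV" by (auto simp: code_def)
  then have "card {p. word p \<in> code} = 2 ^ m * 2 ^ m"
    by (simp only: card_cartesian_product card_F)
  moreover have "{p. word p = 0} = {(a, b). trace_sum a b = 2 ^ m / 2}"
    by (auto simp: trace_sum_weight hamming_weight_supp supp_def vec_eq_iff)
  ultimately have "card {(a, b). trace_sum a b = 2 ^ m / 2} * card code = 2 ^ m * 2 ^ m" by simp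
  then have "real (card {(a, b). trace_sum a b = 2 ^ m / 2} * card code) = real (2 ^ m * 2 ^ m)"
    by (simp only:)
  then show ?thesis by (simp add: freq_def power2_eq_square mult.commute)
qed

lemma has_weight_distributionI:
  assumes "distinct (map fst ws)"
    and freq: "\<And>w A. (w, A) \<in> set ws \<Longrightarrow> freq (2 ^ m / 2 - 2 * real w) = freq (2 ^ m / 2) * A"
    and vals: "\<And>a b. \<exists>w\<in>fst ` set ws. trace_sum a b = 2 ^ m / 2 - 2 * real w"
  shows "has_weight_distribution code ws"
  unfolding has_weight_distribution_def
proof (intro conjI ballI)
  fix p assume "p \<in> set ws"
  moreover obtain w A where p: "p = (w, A)" by (cases p)
  ultimately have "real (card {c \<in> code. hamming_weight c = w}) * freq (2 ^ m / 2) = A * freq (2 ^ m / 2)"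
    using freq[of w A] card_weight_freq[of w] by simp
  then show "case p of (w, A) \<Rightarrow> real (card {c \<in> code. hamming_weight c = w}) = A"
    using freq_pos p by simp
next
  fix c assume "c \<in> code"
  then obtain a b where "c = word (a, b)" by (auto simp: code_def)
  then show "hamming_weight c \<in> fst ` set ws"
    using vals[of a b] trace_sum_weight[of a b] by auto
qed (fact assms(1))

lemma moment_equations:
  fixes A :: real
  assumes A: "0 < A" "2 * A < Q" and Q: "Q = 2 ^ m / 2"
    and vals: "\<And>a b. trace_sum a b \<in> {0, A, - A, 2 * A, - (2 * A), Q, - Q}"
  shows "freq 0 + 2 * freq A + 2 * freq (2 * A) + 2 * freq Q = (2 ^ m) ^ 2"
    and "2 * A ^ 2 * freq A + 8 * A ^ 2 * freq (2 * A) + 2 * Q ^ 2 * freq Q = (2 ^ m) ^ 2 * Q"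
    and "2 * A ^ 4 * freq A + 32 * A ^ 4 * freq (2 * A) + 2 * Q ^ 4 * freq Q =
      (2 ^ m) ^ 2 * (Q * (2 ^ m + 2 ^ m * 2 ^ gcd k m / 4 - 2 ^ gcd k m))"
proof -
  let ?V = "{0, A, - A, 2 * A, - (2 * A), Q, - Q}"
  have fin: "finite ?V" by simp
  \<comment> \<open>The bounds on \<open>A\<close> make the seven values distinct, so the sum over
    the set has seven separate terms.\<close>
  have sum_V: "(\<Sum>v\<in>?V. freq v * g v) = freq 0 * g 0 + freq A * (g A + g (- A)) +
      freq (2 * A) * (g (2 * A) + g (- (2 * A))) + freq Q * (g Q + g (- Q))" for g :: "real \<Rightarrow> real"
    using A by (simp add: freq_uminus algebra_simps)
  note S = sum_freq[OF fin vals, unfolded sum_V]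
  have "(\<Sum>(a, b)\<in>(UNIV :: ('a \<times> 'a) set). 1 :: real) = (2 ^ m) ^ 2"
    by (simp add: case_prod_unfold card_F power2_eq_square card_cartesian_product flip: UNIV_Times_UNIV)
  then show "freq 0 + 2 * freq A + 2 * freq (2 * A) + 2 * freq Q = (2 ^ m) ^ 2"
    using S[of "\<lambda>_. 1"] by simp
  show "2 * A ^ 2 * freq A + 8 * A ^ 2 * freq (2 * A) + 2 * Q ^ 2 * freq Q = (2 ^ m) ^ 2 * Q"
    using S[of "\<lambda>v. v ^ 2"] second_moment[folded Q] by (simp add: algebra_simps)
  show "2 * A ^ 4 * freq A + 32 * A ^ 4 * freq (2 * A) + 2 * Q ^ 4 * freq Q =
      (2 ^ m) ^ 2 * (Q * (2 ^ m + 2 ^ m * 2 ^ gcd k m / 4 - 2 ^ gcd k m))"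
    using S[of "\<lambda>v. v ^ 4"] fourth_moment[folded Q] by (simp add: algebra_simps)
qed

subsection \<open>The dual code\<close>

lemma tr_sum: "tr (\<Sum>i\<in>I. g i) = (\<Sum>i\<in>I. tr (g i))"
  by (induction I rule: infinite_finite_induct) (simp_all add: tr_add)

text \<open>Nondegeneracy of the trace separates the coefficients of \<open>a\<close> and
  \<open>b\<close>: the columns (f(x), x) with x in \<open>D1\<close> form a parity check matrix
  over the large field.\<close>

lemma dual_code_iff:
  "v \<in> dual_code code \<longleftrightarrow> (\<Sum>i\<in>supp v. gold (e i)) = 0 \<and> (\<Sum>i\<in>supp v. e i) = 0"
proof -
  let ?A = "\<Sum>i\<in>supp v. gold (e i)" and ?B = "\<Sum>i\<in>supp v. e i"
  have "(\<Sum>i\<in>UNIV. word (a, b) $ i * v $ i) = tr (?A * a) + tr (?B * b)" for a b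
  proof -
    have "(\<Sum>i\<in>UNIV. word (a, b) $ i * v $ i) = (\<Sum>i\<in>UNIV. if i \<in> supp v then tr (quad a b (e i)) else 0)"
      by (rule sum.cong) (auto simp: word_def supp_def bit_neq_zero_iff)
    also have "\<dots> = (\<Sum>i\<in>supp v. tr (quad a b (e i)))" by (simp add: sum.If_cases)
    also have "\<dots> = tr (?A * a + ?B * b)"
      unfolding tr_sum[symmetric]
      by (simp add: quad_def sum_distrib_left sum.distrib mult.commute)
    finally show ?thesis by (simp add: tr_add)
  qed
  then have "v \<in> dual_code code \<longleftrightarrow> (\<forall>a b. tr (?A * a) + tr (?B * b) = 0)"
    by (auto simp: dual_code_def code_def)
  also have "\<dots> \<longleftrightarrow> (\<forall>a. tr (?A * a) = 0) \<and> (\<forall>b. tr (?B * b) = 0)"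
    by (metis add_0 add_0_right mult_zero_right tr_0)
  finally show ?thesis by (simp only: tr_nondegenerate)
qed

lemma e_D1: "tr (e i) = 1"
  using bij_e by (auto simp: bij_betw_def D1_def)

lemma e_inj: "e i = e j \<longleftrightarrow> i = j"
  using bij_e by (auto simp: bij_betw_def inj_on_def)

text \<open>All coordinates are points of trace 1, so the trace of their vanishing sum is the weight
  modulo 2.\<close>

lemma dual_weight_even:
  assumes "v \<in> dual_code code"
  shows "even (hamming_weight v)"
proof -
  have "tr (\<Sum>i\<in>supp v. e i) = of_nat (hamming_weight v)"
    by (simp add: tr_sum e_D1 hamming_weight_supp)
  then show ?thesis using assms by (simp add: dual_code_iff flip: of_nat_bit_eq_0_iff)
qed

lemma dual_weight_ge_4:
  assumes v: "v \<in> dual_code code" "v \<noteq> 0"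
  shows "4 \<le> hamming_weight v"
proof -
  have "hamming_weight v \<noteq> 0"
  proof
    assume "hamming_weight v = 0"
    then have "supp v = supp 0" by (simp add: hamming_weight_supp supp_def)
    then show False using v by (simp add: supp_eq_iff)
  qed
  moreover have "hamming_weight v \<noteq> 2"
  proof
    assume "hamming_weight v = 2"
    then obtain i j where "supp v = {i, j}" "i \<noteq> j"
      unfolding hamming_weight_supp by (auto simp: card_2_iff)
    then show False using v by (simp add: dual_code_iff add_eq_0_iff_eq e_inj)
  qed
  ultimately show ?thesis using dual_weight_even[OF v(1)] by presburger
qed

text \<open>A word of weight 4 is supported on x, x+u, x+w, x+u+w with \<open>polar u w = 0\<close>.
  Then w/u would be a third element, besides 0 and 1, of a subfield with two elements.\<close>

lemma dual_weight_ge_6: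
  assumes v: "v \<in> dual_code code" "v \<noteq> 0" and l: "gcd k m = 1"
  shows "6 \<le> hamming_weight v"
proof -
  have "hamming_weight v \<noteq> 4"
  proof
    assume "hamming_weight v = 4"
    then have c4: "card (supp v) = 4" by (simp add: hamming_weight_supp)
    then obtain h T where T: "supp v = insert h T" "h \<notin> T" "card T = 3"
      using card_Suc_eq[of "supp v" 3] by auto
    then obtain i j l where ijl: "supp v = {h, i, j, l}"
      and dist: "h \<noteq> i" "h \<noteq> j" "h \<noteq> l" "i \<noteq> j" "i \<noteq> l" "j \<noteq> l"
      by (auto simp: card_3_iff)
    define x u w where "x = e h" and "u = e h + e i" and "w = e h + e j"
    have s: "e h + (e i + (e j + e l)) = 0" "gold (e h) + (gold (e i) + (gold (e j) + gold (e l))) = 0"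
      using v(1) dist unfolding dual_code_iff ijl by auto
    have ei: "e i = x + u" "e j = x + w" by (simp_all add: x_def u_def w_def)
    have el: "e l = x + u + w"
      using s(1) add_eq_0_iff_eq[of "e h + e i + e j" "e l"] by (simp add: x_def u_def w_def ac_simps)
    have "polar u w = 0"
      using gold_four[of x u w] s(2) unfolding ei el x_def[symmetric] by (simp add: ac_simps)
    moreover have u0: "u \<noteq> 0" using dist by (simp add: u_def add_eq_0_iff_eq e_inj)
    ultimately have K: "w / u \<in> frob_fixed k" by (simp add: polar_eq_0_iff)
    have "w / u \<noteq> 0" using dist u0 by (simp add: w_def add_eq_0_iff_eq e_inj)
    moreover have "w / u \<noteq> 1" using dist u0 by (simp add: w_def u_def e_inj)
    ultimately have "card {0, 1, w / u} = 3" by (auto simp: card_insert_if)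
    moreover have "card {0, 1, w / u} \<le> card (frob_fixed k)"
      using K by (intro card_mono) (auto simp: frob_fixed_def)
    ultimately show False using card_frob_fixed[of k] l by simp
  qed
  then show ?thesis using dual_weight_even[OF v(1)] dual_weight_ge_4[OF v] by presburger
qed

text \<open>A subfield element s other than 0 and 1 gives a word on x, x+u, x+us, x+u+us. A suitable
  nonzero u exists because the two trace conditions leave 2^m / 4 > 1 solutions.\<close>

lemma dual_weight_4:
  assumes m: "m \<ge> 4" and l: "2 \<le> gcd k m"
  shows "\<exists>v\<in>dual_code code. v \<noteq> 0 \<and> hamming_weight v = 4"
proof -
  have "\<not> frob_fixed k \<subseteq> {0, 1}"
  proof
    assume "frob_fixed k \<subseteq> {0, 1}"
    then have "card (frob_fixed k) \<le> card {0, 1 :: 'a}" by (intro card_mono) auto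
    moreover have "(2::nat) ^ 2 \<le> 2 ^ gcd k m" using l by (intro power_increasing) auto
    ultimately show False using card_frob_fixed[of k] by simp
  qed
  then obtain s where s: "s \<in> frob_fixed k" "s \<noteq> 0" "s \<noteq> 1" by blast
  have "\<not> {u. tr u = 0 \<and> tr (u * s) = 0} \<subseteq> {0}"
  proof
    assume "{u. tr u = 0 \<and> tr (u * s) = 0} \<subseteq> {0}"
    then have "card {u. tr u = 0 \<and> tr (u * s) = 0} \<le> card {0 :: 'a}" by (intro card_mono) auto
    then have "(2::real) ^ m / 4 \<le> 1" using card_tr_0_pair[of s] s by simp
    moreover have "(2::real) ^ 4 \<le> 2 ^ m" using m by (intro power_increasing) auto
    ultimately show False by simp
  qed
  then obtain u where u: "tr u = 0" "tr (u * s) = 0" "u \<noteq> 0" by blast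
  define w where "w = u * s"
  have w: "tr w = 0" "w \<noteq> 0" "u \<noteq> w" "polar u w = 0"
    using u s by (auto simp: w_def polar_eq_0_iff)
  obtain x where x: "tr x = 1" using tr_surj by blast
  define X where "X = {x, x + u, x + w, x + u + w}"
  have "x + u + w \<noteq> x"
  proof
    assume "x + u + w = x"
    then have "u + w = 0" by (simp add: add.assoc)
    then show False using w by (simp add: add_eq_0_iff_eq)
  qed
  then have dist: "x \<noteq> x + u" "x \<noteq> x + w" "x \<noteq> x + u + w" "x + u \<noteq> x + w"
    "x + u \<noteq> x + u + w" "x + w \<noteq> x + u + w" using u w by (auto simp: add.assoc)
  have XD: "X \<subseteq> D1" using x u w by (auto simp: X_def D1_def tr_add)
  define v :: "bit ^ 'n" where "v = (\<chi> i. of_bool (e i \<in> X))"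
  have bij: "bij_betw e (supp v) X"
    using bij_e XD unfolding bij_betw_def supp_def v_def by (auto simp: inj_on_def)
  have wt: "hamming_weight v = 4"
    using bij_betw_same_card[OF bij] dist by (simp add: hamming_weight_supp X_def card_insert_if)
  have sum_v: "(\<Sum>i\<in>supp v. g (e i)) = g x + g (x + u) + (g (x + w) + g (x + u + w))"
    for g :: "'a \<Rightarrow> 'a"
  proof -
    have "(\<Sum>i\<in>supp v. g (e i)) = (\<Sum>y\<in>X. g y)" by (rule sum.reindex_bij_betw[OF bij])
    also have "\<dots> = g x + (g (x + u) + (g (x + w) + g (x + u + w)))"
      unfolding X_def using dist by simp
    finally show ?thesis by (simp only: add.assoc)
  qed
  have "x + (x + u) + (x + w + (x + u + w)) = 0" by (simp add: ac_simps)
  then have "v \<in> dual_code code"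
    unfolding dual_code_iff using sum_v[of gold] sum_v[of "\<lambda>y. y"] gold_four[of x u w] w(4)
    by (simp only:)
  moreover have "v \<noteq> 0" using wt by (auto simp: hamming_weight_def)
  ultimately show ?thesis using wt by blast
qed

lemma card_dual:
  assumes "card code = 2 ^ \<kappa>"
  shows "card (dual_code code) = 2 ^ (2 ^ (m - 1) - \<kappa>)" and "\<kappa> \<le> 2 ^ (m - 1)"
proof -
  have eq: "2 ^ \<kappa> * card (dual_code code) = 2 ^ 2 ^ (m - 1)"
    using card_dual_code[OF subspace_code] assms card_n by simp
  then have "(2::nat) ^ \<kappa> dvd 2 ^ 2 ^ (m - 1)" by (metis dvd_triv_left)
  then show \<kappa>: "\<kappa> \<le> 2 ^ (m - 1)" by (rule power_dvd_imp_le) simp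
  then have "(2::nat) ^ \<kappa> * 2 ^ (2 ^ (m - 1) - \<kappa>) = 2 ^ 2 ^ (m - 1)"
    by (simp flip: power_add)
  then show "card (dual_code code) = 2 ^ (2 ^ (m - 1) - \<kappa>)"
    using eq by (metis mult_cancel1 power_not_zero zero_neq_numeral)
qed

lemma dual_is_code_4:
  assumes "card code = 2 ^ \<kappa>" "m \<ge> 4" "2 \<le> gcd k m"
  shows "is_code (dual_code code) (2 ^ (m - 1)) (2 ^ (m - 1) - \<kappa>) 4"
proof -
  obtain v where "v \<in> dual_code code" "v \<noteq> 0" "hamming_weight v = 4"
    using dual_weight_4 assms by blast
  then show ?thesis
    using card_dual[OF assms(1)] dual_weight_ge_4
    by (intro is_codeI) (auto simp: card_n subspace_dual_code)
qed

text \<open>No word of weight 6 is constructed: the dual is nonzero and so has a minimum distance,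
  which is at least 6 by \<open>dual_weight_ge_6\<close> and at most 6 by
  \<open>bound\<close>.\<close>

lemma dual_distance_optimal_6:
  assumes \<kappa>: "card code = 2 ^ \<kappa>" "\<kappa> < 2 ^ (m - 1)" and l: "gcd k m = 1"
    and bound: "\<And>(S :: (bit ^ 'n) set) d. is_code S (2 ^ (m - 1)) (2 ^ (m - 1) - \<kappa>) d \<Longrightarrow> d \<le> 6"
  shows "distance_optimal (dual_code code) (2 ^ (m - 1)) (2 ^ (m - 1) - \<kappa>) 6"
proof -
  have "\<exists>d. is_code (dual_code code) (2 ^ (m - 1)) (2 ^ (m - 1) - \<kappa>) d"
    using card_dual[OF \<kappa>(1)] \<kappa> by (intro ex_is_code) (auto simp: card_n subspace_dual_code)
  then obtain d where d: "is_code (dual_code code) (2 ^ (m - 1)) (2 ^ (m - 1) - \<kappa>) d" by blast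
  then obtain u v where uv: "u \<in> dual_code code" "v \<in> dual_code code" "u \<noteq> v" "hamming_dist u v = d"
    by (auto simp: is_code_def)
  have "u + v \<in> dual_code code" using uv subspace_dual_code vec.subspace_add by blast
  moreover have "u + v \<noteq> 0" using uv by (metis bit_vec_diff right_minus_eq)
  ultimately have "6 \<le> d" using dual_weight_ge_6 l uv by (auto simp: hamming_dist_add)
  then have "d = 6" using bound[OF d] by simp
  then show ?thesis using d bound by (fastforce simp: distance_optimal_def)
qed

subsection \<open>The weight distributions\<close>

text \<open>A sum T belongs to the weight \<open>X\<close> - T/2, so the values +-A and +-2A with A
  = \<open>2 * Y\<close> shift the weight by \<open>Y\<close> and \<open>2 * Y\<close>. Dividing by
  \<open>freq (2 ^ m / 2)\<close> turns pairs into codewords.\<close>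

lemma weight_distribution_seven:
  assumes m: "2 \<le> m" and X: "X = 2 ^ (m - 2)" and Y: "0 < Y" "2 * Y < X"
    and vals: "\<And>a b. trace_sum a b \<in>
      {0, 2 * real Y, - (2 * real Y), 4 * real Y, - (4 * real Y), 2 ^ m / 2, - (2 ^ m / 2)}"
    and n: "freq 0 = freq (2 ^ m / 2) * n0" "freq (2 * real Y) = freq (2 ^ m / 2) * n1"
      "freq (4 * real Y) = freq (2 ^ m / 2) * n2"
  shows "has_weight_distribution code
    [(0, 1), (X, n0), (X + 2 * Y, n2), (X - 2 * Y, n2), (X + Y, n1), (X - Y, n1), (2 * X, 1)]"
proof -
  have q: "2 ^ m / 2 = 2 * real X"
    using power_add[of "2::real" "m - 2" 2, unfolded le_add_diff_inverse2[OF m]] by (simp add: X)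
  have sub: "2 * real (X - 2 * Y) = 2 * real X - 4 * real Y"
    "2 * real (X - Y) = 2 * real X - 2 * real Y"
    using Y by (simp_all add: of_nat_diff)
  have shift: "2 * real X - (2 * real X + 4 * real Y) = - (4 * real Y)"
    "2 * real X - (2 * real X - 4 * real Y) = 4 * real Y"
    "2 * real X - (2 * real X + 2 * real Y) = - (2 * real Y)"
    "2 * real X - (2 * real X - 2 * real Y) = 2 * real Y"
    "2 * real X - 4 * real X = - (2 * real X)"
    by simp_all
  show ?thesis
  proof (rule has_weight_distributionI)
    fix w A
    assume "(w, A) \<in> set [(0, 1), (X, n0), (X + 2 * Y, n2), (X - 2 * Y, n2), (X + Y, n1), (X - Y, n1), (2 * X, 1)]"
    then show "freq (2 ^ m / 2 - 2 * real w) = freq (2 ^ m / 2) * A"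
      using n unfolding q
      by (auto simp: sub shift freq_uminus)
  next
    fix a b
    show "\<exists>w\<in>fst ` set [(0, 1), (X, n0), (X + 2 * Y, n2), (X - 2 * Y, n2), (X + Y, n1), (X - Y, n1), (2 * X, 1)].
        trace_sum a b = 2 ^ m / 2 - 2 * real w"
      using vals[of a b] unfolding q by (auto simp: sub)
  qed (use Y in auto)
qed

lemma weight_distribution_five:
  assumes m: "2 \<le> m" and X: "X = 2 ^ (m - 2)" and Y: "0 < Y" "Y < X"
    and vals: "\<And>a b. trace_sum a b \<in> {0, 2 * real Y, - (2 * real Y), 2 ^ m / 2, - (2 ^ m / 2)}"
    and n: "freq 0 = freq (2 ^ m / 2) * n0" "freq (2 * real Y) = freq (2 ^ m / 2) * n1"
  shows "has_weight_distribution code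
    [(0, 1), (X, n0), (X + Y, n1), (X - Y, n1), (2 * X, 1)]"
proof -
  have q: "2 ^ m / 2 = 2 * real X"
    using power_add[of "2::real" "m - 2" 2, unfolded le_add_diff_inverse2[OF m]] by (simp add: X)
  have sub: "real (X - Y) = real X - real Y"
    using Y by (simp add: of_nat_diff)
  show ?thesis
  proof (rule has_weight_distributionI)
    fix w A
    assume "(w, A) \<in> set [(0, 1), (X, n0), (X + Y, n1), (X - Y, n1), (2 * X, 1)]"
    then show "freq (2 ^ m / 2 - 2 * real w) = freq (2 ^ m / 2) * A"
      using n freq_uminus[of "2 * real Y"] freq_uminus[of "2 * real X"]
      unfolding q by (auto simp: sub algebra_simps)
  next
    fix a b
    show "\<exists>w\<in>fst ` set [(0, 1), (X, n0), (X + Y, n1), (X - Y, n1), (2 * X, 1)].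
        trace_sum a b = 2 ^ m / 2 - 2 * real w"
      using vals[of a b] unfolding q by (auto simp: sub)
  qed (use Y in auto)
qed

text \<open>Since 2A is below q/2, the value q/2 arises only for a = 0, and there only for b = 0.
  Hence distinct pairs give distinct codewords.\<close>

lemma small_trace_sums:
  assumes A: "0 < A" "2 * A < 2 ^ m / 2"
    and small: "\<And>a b. a \<noteq> 0 \<Longrightarrow> trace_sum a b \<in> {0, A, - A, 2 * A, - (2 * A)}"
  shows "trace_sum a b \<in> {0, A, - A, 2 * A, - (2 * A), 2 ^ m / 2, - (2 ^ m / 2)}"
    and "freq (2 ^ m / 2) = 1"
proof -
  show "trace_sum a b \<in> {0, A, - A, 2 * A, - (2 * A), 2 ^ m / 2, - (2 ^ m / 2)}"
    using small[of a b] trace_sum_zero_left[of b] by (cases "a = 0") auto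
  have "trace_sum a b = 2 ^ m / 2 \<longleftrightarrow> a = 0 \<and> b = 0" for a b
    using small[of a b] trace_sum_zero_left[of b] A by (cases "a = 0") auto
  then have "{(a, b). trace_sum a b = 2 ^ m / 2} = {(0, 0)}" by auto
  then show "freq (2 ^ m / 2) = 1" by (simp add: freq_def)
qed

lemma card_code_faithful:
  assumes "freq (2 ^ m / 2) = 1"
  shows "card code = 2 ^ (2 * m)"
proof -
  have "real (card code) = real (2 ^ (2 * m))"
    using card_code assms by (simp add: power_mult mult.commute)
  then show ?thesis by (simp only: of_nat_eq_iff)
qed

section \<open>Radicals and frequencies in the three cases\<close>

lemma inj_gold:
  assumes g: "gcd (2 * k) m = gcd k m"
  shows "inj gold"
proof (rule injI)
  fix x y assume xy: "gold x = gold y"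
  show "x = y"
  proof (cases "y = 0")
    case True
    then show ?thesis using xy by (simp add: gold_def)
  next
    case False
    \<comment> \<open>The ratio satisfies s^(2^k) = 1/s, hence is fixed by the 2k-th Frobenius power
      and, as the two gcds agree, by the k-th. So s^2 = 1, and s = 1 in characteristic 2.\<close>
    define s where "s = x / y"
    have s1: "s ^ (2 ^ k) * s = 1"
      using xy False by (simp add: s_def gold_def power_divide mult.commute)
    then have "(s ^ (2 ^ k) * s) ^ (2 ^ k) = s ^ (2 ^ k) * s" by simp
    then have "(s ^ (2 ^ k)) ^ (2 ^ k) = s"
      using s1 by (auto simp: power_mult_distrib mult.commute)
    then have "s \<in> frob_fixed (2 * k)"
      by (simp add: frob_fixed_def mult_2 power_add power_mult)
    then have "s \<in> frob_fixed k" using frob_fixed_gcd[of k] frob_fixed_gcd[of "2 * k"] g by simp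
    then have "s * s = 1" using s1 by (simp add: frob_fixed_def)
    then have "s ^ (2 ^ 1) = 1 ^ (2 ^ 1)" by (simp add: power2_eq_square)
    then have "s = 1" by (simp only: frob_eq_iff)
    then show ?thesis using False by (simp add: s_def)
  qed
qed

text \<open>Injectivity provides w with \<open>a * gold w = 1\<close>. As 1 is fixed by Frobenius,
  raising this equation to the power 2^k and comparing shows that w is a nonzero element of the
  radical.\<close>

lemma card_radical_inj:
  assumes g: "gcd (2 * k) m = gcd k m" and a: "a \<noteq> 0"
  shows "card (radical a) = 2 ^ gcd k m"
proof -
  have "surj gold" using inj_gold[OF g] by (simp add: finite_UNIV_inj_surj)
  then obtain w where w: "gold w = 1 / a" by (metis surjD)
  then have w0: "w \<noteq> 0" using a by auto
  have aw: "a * w * w ^ (2 ^ k) = 1" using w a by (simp add: gold_def mult_ac)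
  have "(a * w * w ^ (2 ^ k)) ^ (2 ^ k) = a * w * w ^ (2 ^ k)" unfolding aw by simp
  then have "a ^ (2 ^ k) * (w ^ (2 ^ k)) ^ (2 ^ k) * w ^ (2 ^ k) = a * w * w ^ (2 ^ k)"
    by (simp add: power_mult_distrib mult_ac)
  then have "w \<in> radical a" using w0 by (simp add: radical_def frob_double)
  then show ?thesis using card_radical[of w a] w0 a g by simp
qed

lemma frequencies_multiplicity_le:
  fixes A :: real
  assumes A: "0 < A" "2 * A < 2 ^ m / 2" and A2: "4 * A ^ 2 = 2 ^ m * 2 ^ l" and l: "l = gcd k m"
    and small: "\<And>a b. a \<noteq> 0 \<Longrightarrow> trace_sum a b \<in> {0, A, - A, 2 * A, - (2 * A)}"
  shows "(2 ^ l) ^ 2 * freq (2 * A) = ((2 ^ m) ^ 2 - 2 ^ m * 2 ^ l) / 4"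
    and "(2 ^ l) ^ 2 * freq A = (2 ^ m) ^ 2 * 2 ^ l - (2 ^ m) ^ 2"
    and "freq 0 = (2 ^ m) ^ 2 - 2 - 2 * freq A - 2 * freq (2 * A)"
proof -
  define q L :: real where "q = 2 ^ m" and "L = 2 ^ l"
  have pos: "q > 0" "L > 0" by (simp_all add: q_def L_def)
  have vals: "trace_sum a b \<in> {0, A, - A, 2 * A, - (2 * A), 2 ^ m / 2, - (2 ^ m / 2)}" for a b
    by (rule small_trace_sums(1)[OF A]) (fact small)
  have Q1: "freq (2 ^ m / 2) = 1"
    by (rule small_trace_sums(2)[OF A]) (fact small)
  note M = moment_equations[OF A refl vals, unfolded Q1 l[symmetric],
      folded q_def L_def]
  have A2': "A ^ 2 = q * L / 4" using A2 by (simp add: q_def L_def)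
  have "A ^ 4 = (A ^ 2) ^ 2" by simp
  then have A4: "A ^ 4 = q ^ 2 * L ^ 2 / 16" unfolding A2' by (simp add: power_divide power_mult_distrib)
  have "q * (L * freq A + 4 * L * freq (2 * A)) = q * (q ^ 2 - q)"
    using M(2) unfolding A2' by (simp add: algebra_simps power2_eq_square power3_eq_cube)
  then have 1: "L * freq A + 4 * L * freq (2 * A) = q ^ 2 - q" using pos by simp
  have "q ^ 2 * (L ^ 2 * freq A + 16 * L ^ 2 * freq (2 * A)) = q ^ 2 * (3 * q ^ 2 + q ^ 2 * L - 4 * q * L)"
    using M(3) unfolding A4 by (simp add: field_simps power2_eq_square power4_eq_xxxx)
  then have 2: "L ^ 2 * freq A + 16 * L ^ 2 * freq (2 * A) = 3 * q ^ 2 + q ^ 2 * L - 4 * q * L"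
    using pos by simp
  \<comment> \<open>Scaling the second moment by L makes both equations linear in the same unknowns,
    the frequencies times L^2.\<close>
  have "L * (L * freq A + 4 * L * freq (2 * A)) = L * (q ^ 2 - q)" unfolding 1 ..
  then have 3: "L ^ 2 * freq A + 4 * (L ^ 2 * freq (2 * A)) = q ^ 2 * L - q * L"
    by (simp add: algebra_simps power2_eq_square)
  show "(2 ^ l) ^ 2 * freq (2 * A) = ((2 ^ m) ^ 2 - 2 ^ m * 2 ^ l) / 4"
    using 2 3 unfolding q_def[symmetric] L_def[symmetric] by (simp add: field_simps)
  show "(2 ^ l) ^ 2 * freq A = (2 ^ m) ^ 2 * 2 ^ l - (2 ^ m) ^ 2"
    using 2 3 unfolding q_def[symmetric] L_def[symmetric] by (simp add: field_simps)
  show "freq 0 = (2 ^ m) ^ 2 - 2 - 2 * freq A - 2 * freq (2 * A)"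
    using M(1) unfolding q_def[symmetric] by simp
qed

text \<open>The fourth moment is the one for L = 2, but A^2 is q instead of q L / 4: the count of
  solutions depends on gcd(k,m) = 1, the radical on gcd(2k,m) = 2.\<close>

lemma frequencies_coprime:
  fixes A :: real
  assumes A: "0 < A" "2 * A < 2 ^ m / 2" and A2: "A ^ 2 = 2 ^ m" and l: "gcd k m = 1"
    and small: "\<And>a b. a \<noteq> 0 \<Longrightarrow> trace_sum a b \<in> {0, A, - A, 2 * A, - (2 * A)}"
  shows "freq (2 * A) = ((2 ^ m) ^ 2 / 64 - 2 ^ m / 16) / 3"
    and "freq A = (11 * (2 ^ m) ^ 2 / 8 - 2 ^ m) / 6"
    and "freq 0 = (2 ^ m) ^ 2 - 2 - 2 * freq A - 2 * freq (2 * A)"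
proof -
  define q :: real where "q = 2 ^ m"
  have pos: "q > 0" by (simp add: q_def)
  have vals: "trace_sum a b \<in> {0, A, - A, 2 * A, - (2 * A), 2 ^ m / 2, - (2 ^ m / 2)}" for a b
    by (rule small_trace_sums(1)[OF A]) (fact small)
  have Q1: "freq (2 ^ m / 2) = 1"
    by (rule small_trace_sums(2)[OF A]) (fact small)
  note M = moment_equations[OF A refl vals, unfolded Q1 l power_one_right,
      folded q_def]
  have A2': "A ^ 2 = q" using A2 by (simp add: q_def)
  have "A ^ 4 = (A ^ 2) ^ 2" by simp
  then have A4: "A ^ 4 = q ^ 2" unfolding A2' .
  have "q * (2 * freq A + 8 * freq (2 * A)) = q * (q ^ 2 / 2 - q / 2)"
    using M(2) unfolding A2' by (simp add: field_simps power2_eq_square power3_eq_cube)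
  then have 1: "2 * freq A + 8 * freq (2 * A) = q ^ 2 / 2 - q / 2" using pos by simp
  have "q ^ 2 * (2 * freq A + 32 * freq (2 * A)) = q ^ 2 * (5 * q ^ 2 / 8 - q)"
    using M(3) unfolding A4 by (simp add: field_simps power2_eq_square power4_eq_xxxx)
  then have 2: "2 * freq A + 32 * freq (2 * A) = 5 * q ^ 2 / 8 - q" using pos by simp
  show "freq (2 * A) = ((2 ^ m) ^ 2 / 64 - 2 ^ m / 16) / 3"
    using 1 2 unfolding q_def[symmetric] by (simp add: field_simps)
  show "freq A = (11 * (2 ^ m) ^ 2 / 8 - 2 ^ m) / 6"
    using 1 2 unfolding q_def[symmetric] by (simp add: field_simps)
  show "freq 0 = (2 ^ m) ^ 2 - 2 - 2 * freq A - 2 * freq (2 * A)"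
    using M(1) unfolding q_def[symmetric] by simp
qed

text \<open>For y in the subfield the power sum defining the trace consists of two equal halves and
  vanishes. For a outside the subfield, the 2k-th Frobenius power is the identity and the radical
  equation becomes (a^(2^k) - a) u = 0.\<close>

lemma trace_sum_half:
  assumes m: "m = 2 * k" and k: "k \<ge> 2"
  shows "a \<in> frob_fixed k \<Longrightarrow> trace_sum a b = trace_sum 0 b"
    and "a \<notin> frob_fixed k \<Longrightarrow> trace_sum a b \<in> {0, 2 ^ k, - (2 ^ k)}"
proof -
  have tr0: "tr y = 0" if "y \<in> frob_fixed k" for y
  proof -
    have y: "y ^ (2 ^ k) = y" using that by (simp add: frob_fixed_def)
    have "(of_bit (tr y) :: 'a) = (\<Sum>i<k + k. y ^ (2 ^ i))"
      unfolding of_bit_tr by (simp add: m mult_2)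
    also have "\<dots> = (\<Sum>i<k. y ^ (2 ^ i)) + (\<Sum>i<k. y ^ (2 ^ (k + i)))"
      by (rule sum_lessThan_add)
    also have "(\<Sum>i<k. y ^ (2 ^ (k + i))) = (\<Sum>i<k. y ^ (2 ^ i))"
      by (simp add: power_add power_mult y)
    finally have "(of_bit (tr y) :: 'a) = of_bit 0" by simp
    then show ?thesis by (simp only: of_bit_eq_iff)
  qed
  have gold_fixed: "gold x \<in> frob_fixed k" for x
  proof -
    have "(x ^ (2 ^ k)) ^ (2 ^ k) = x"
      using frob_card[of x] by (simp add: m mult_2 power_add power_mult)
    then show ?thesis by (simp add: frob_fixed_def gold_def power_mult_distrib mult.commute)
  qed
  {
    assume a: "a \<in> frob_fixed k"
    have "tr (a * gold x) = 0" for x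
      using a gold_fixed[of x] by (intro tr0) (simp add: frob_fixed_def power_mult_distrib)
    then show "trace_sum a b = trace_sum 0 b"
      by (simp add: trace_sum_def quad_def psi_def tr_add)
  next
    assume a: "a \<notin> frob_fixed k"
    have "radical a = {0}"
    proof (intro equalityI subsetI)
      fix u assume "u \<in> radical a"
      then have "a ^ (2 ^ k) * u = a * u"
        using frob_card[of u] by (simp add: radical_def m)
      then show "u \<in> {0}" using a by (simp add: frob_fixed_def)
    qed (simp add: zero_in_radical)
    moreover have "(2::real) ^ m = (2 ^ k) ^ 2" by (simp add: m power_mult mult.commute)
    ultimately show "trace_sum a b \<in> {0, 2 ^ k, - (2 ^ k)}"
      by (rule trace_sum_values_trivial_radical)
  }
qed

lemma frequencies_half:
  assumes m: "m = 2 * k" and k: "k \<ge> 2"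
  shows "trace_sum a b \<in> {0, 2 ^ k, - (2 ^ k), 2 ^ m / 2, - (2 ^ m / 2)}"
    and "freq (2 ^ m / 2) = 2 ^ k"
    and "freq (2 ^ k) = ((2 ^ m) ^ 2 - 2 ^ m * 2 ^ k) / 4"
    and "freq 0 = (2 ^ m) ^ 2 - 2 * 2 ^ k - 2 * freq (2 ^ k)"
proof -
  have gcd_k: "gcd k m = k" using m by simp
  \<comment> \<open>An auxiliary value that is never attained: the actual values are +-2B, and the
    frequency of B is 0, so the second moment alone determines the frequency of 2B.\<close>
  define B :: real where "B = 2 ^ k / 2"
  have B: "0 < B" "2 * B < 2 ^ m / 2" "2 * B = 2 ^ k"
  proof -
    have "(2::real) ^ (k + 1) < 2 ^ m" using m k by (intro power_strict_increasing) auto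
    then show "0 < B" "2 * B < 2 ^ m / 2" "2 * B = 2 ^ k" by (simp_all add: B_def)
  qed
  show vals: "trace_sum a b \<in> {0, 2 ^ k, - (2 ^ k), 2 ^ m / 2, - (2 ^ m / 2)}" for a b
    using trace_sum_half[OF m k, of a b] trace_sum_zero_left[of b]
    by (cases "a \<in> frob_fixed k") auto
  have "trace_sum a b = 2 ^ m / 2 \<longleftrightarrow> a \<in> frob_fixed k \<and> b = 0" for a b
    using trace_sum_half[OF m k, of a b] trace_sum_zero_left[of b] B
    by (cases "a \<in> frob_fixed k") auto
  then have "{(a, b). trace_sum a b = 2 ^ m / 2} = frob_fixed k \<times> {0}" by auto
  then show Q: "freq (2 ^ m / 2) = 2 ^ k"
    using card_frob_fixed[of k] gcd_k by (simp add: freq_def card_cartesian_product)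
  have "trace_sum a b \<noteq> B" for a b
    using vals[of a b] B by auto
  then have B0: "freq B = 0" by (simp add: freq_def)
  have vals': "trace_sum a b \<in> {0, B, - B, 2 * B, - (2 * B), 2 ^ m / 2, - (2 ^ m / 2)}" for a b
    using vals[of a b] unfolding B(3) by auto
  define q :: real where "q = 2 ^ m"
  have q0: "q > 0" by (simp add: q_def)
  note M = moment_equations[OF B(1,2) refl vals', unfolded B(3) B0 Q, folded q_def]
  have "(2 * B) ^ 2 = q" unfolding B(3) q_def by (simp add: m power_mult mult.commute)
  then have B2: "B ^ 2 = q / 4" by (simp add: power_mult_distrib)
  have "q * (4 * freq (2 ^ k)) = q * (q ^ 2 - q * 2 ^ k)"
    using M(2) unfolding B2 by (simp add: field_simps power2_eq_square power3_eq_cube)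
  then have "4 * freq (2 ^ k) = q ^ 2 - q * 2 ^ k" using q0 by simp
  then show "freq (2 ^ k) = ((2 ^ m) ^ 2 - 2 ^ m * 2 ^ k) / 4"
    unfolding q_def[symmetric] by simp
  show "freq 0 = (2 ^ m) ^ 2 - 2 * 2 ^ k - 2 * freq (2 ^ k)"
    using M(1) unfolding q_def[symmetric] by simp
qed

section \<open>Parameters of the code and its dual in the three cases\<close>

lemma parameters_multiplicity_le:
  assumes m: "4 \<le> m" and k: "0 < k" "k < m" and l: "l = gcd k m"
    and v: "multiplicity 2 m \<le> multiplicity 2 k"
  shows "is_code code (2 ^ (m - 1)) (2 * m) (2 ^ (m - 2) - 2 ^ ((m + l - 2) div 2))" (is ?code)
    and "has_weight_distribution code
         [(0, 1),
          (2 ^ (m - 2),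
             2 ^ (2 * m) - 2 ^ (2 * m - l + 1) + 3 * 2 ^ (2 * m - 2 * l - 1) + 2 ^ (m - l - 1) - 2),
          (2 ^ (m - 2) + 2 ^ ((m + l - 2) div 2), 2 ^ (2 * m - 2 * l - 2) - 2 ^ (m - l - 2)),
          (2 ^ (m - 2) - 2 ^ ((m + l - 2) div 2), 2 ^ (2 * m - 2 * l - 2) - 2 ^ (m - l - 2)),
          (2 ^ (m - 2) + 2 ^ ((m + l - 4) div 2), 2 ^ (2 * m - l) - 2 ^ (2 * m - 2 * l)),
          (2 ^ (m - 2) - 2 ^ ((m + l - 4) div 2), 2 ^ (2 * m - l) - 2 ^ (2 * m - 2 * l)),
          (2 ^ (m - 1), 1)]" (is "has_weight_distribution code ?ws")
    and "l \<ge> 2 \<Longrightarrow> is_code (dual_code code) (2 ^ (m - 1)) (2 ^ (m - 1) - 2 * m) 4"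
    and "l = 1 \<Longrightarrow> distance_optimal (dual_code code) (2 ^ (m - 1)) (2 ^ (m - 1) - 2 * m) 6"
proof -
  have g: "gcd (2 * k) m = gcd k m" and "odd (m div gcd k m)"
    using gcd_double_of_multiplicity_le[OF k(1) m_pos v] by auto
  \<comment> \<open>The odd quotient of m by l is not 1, because l is at most k < m. Hence m is at
    least 3l, and m + l is even, so the halved exponents below are exact.\<close>
  then obtain r where r: "m = l * (2 * r + 1)"
    unfolding l by (metis dvd_div_mult_self gcd_dvd2 mult.commute oddE)
  have l0: "l > 0" using k by (simp add: l)
  have "l \<le> k" using k by (simp add: l)
  then have "r \<noteq> 0" using r k by (intro notI) simp
  then have "l * 3 \<le> m" unfolding r by (intro mult_left_mono) auto
  then have lm: "l + 2 < m" using m by linarith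
  have "even (m + l)" by (simp add: r)
  then obtain h' where h': "m + l = 2 * h'" by (rule evenE)
  define h where "h = h' - 2"
  have h: "m + l = 2 * h + 4" using h' m unfolding h_def by simp
  have exps: "(m + l - 2) div 2 = h + 1" "(m + l - 4) div 2 = h" using h by simp_all
  have hm: "h + 1 < m - 2" using h lm by linarith
  have m2: "2 \<le> m" using m by simp
  define Y :: nat where "Y = 2 ^ h"
  define A :: real where "A = 2 * real Y"
  have A4: "2 * A = 4 * real Y" by (simp add: A_def)
  have YX: "2 * Y < 2 ^ (m - 2)"
    using power_strict_increasing[OF hm, of "2::nat"] by (simp add: Y_def)
  have q: "2 ^ m / 2 = 2 * real (2 ^ (m - 2))"
    using power_add[of "2::real" "m - 2" 2, unfolded le_add_diff_inverse2[OF m2]] by simp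
  have A: "0 < A" "2 * A < 2 ^ m / 2"
  proof -
    have "real (2 * Y) < real (2 ^ (m - 2))" using YX by (simp only: of_nat_less_iff)
    then show "0 < A" "2 * A < 2 ^ m / 2" unfolding q A4 by (simp_all add: A_def Y_def)
  qed
  have "4 * A ^ 2 = 2 ^ (2 * h + 4)"
    by (simp add: A_def Y_def power_add power_even_eq power_mult_distrib)
  then have A2: "4 * A ^ 2 = 2 ^ m * 2 ^ l" by (simp only: h[symmetric] power_add)
  have small: "trace_sum a b \<in> {0, A, - A, 2 * A, - (2 * A)}" if "a \<noteq> 0" for a b
    using A2 card_radical_inj[OF g that]
    by (intro trace_sum_values) (simp add: l power_mult_distrib)
  have vals: "trace_sum a b \<in> {0, A, - A, 2 * A, - (2 * A), 2 ^ m / 2, - (2 ^ m / 2)}" for a b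
    by (rule small_trace_sums(1)[OF A]) (fact small)
  have Q1: "freq (2 ^ m / 2) = 1" by (rule small_trace_sums(2)[OF A]) (fact small)
  have F: "(2 ^ l) ^ 2 * freq (2 * A) = ((2 ^ m) ^ 2 - 2 ^ m * 2 ^ l) / 4"
    "(2 ^ l) ^ 2 * freq A = (2 ^ m) ^ 2 * 2 ^ l - (2 ^ m) ^ 2"
    "freq 0 = (2 ^ m) ^ 2 - 2 - 2 * freq A - 2 * freq (2 * A)"
    using frequencies_multiplicity_le[OF A A2 l] small by blast+
  have "l + 2 \<le> m" using lm by simp
  note N = multiplicities_multiplicity_le[OF this F]
  have "2 * 2 ^ (m - 2) = (2::nat) ^ (m - 1)"
    using m by (simp flip: power_Suc add: Suc_diff_le)
  moreover have "2 * Y = 2 ^ ((m + l - 2) div 2)" "Y = 2 ^ ((m + l - 4) div 2)"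
    unfolding exps by (simp_all add: Y_def)
  moreover have "has_weight_distribution code
    [(0, 1), (2 ^ (m - 2), freq 0), (2 ^ (m - 2) + 2 * Y, freq (2 * A)), (2 ^ (m - 2) - 2 * Y, freq (2 * A)),
     (2 ^ (m - 2) + Y, freq A), (2 ^ (m - 2) - Y, freq A), (2 * 2 ^ (m - 2), 1)]"
    using m YX vals Q1 by (intro weight_distribution_seven) (auto simp: A4 A_def Y_def)
  ultimately show W: "has_weight_distribution code ?ws"
    unfolding N by (simp only:)
  have cc: "card code = 2 ^ (2 * m)" by (rule card_code_faithful[OF Q1])
  have lt: "(2::nat) ^ ((m + l - 2) div 2) < 2 ^ (m - 2)" "(2::nat) ^ ((m + l - 4) div 2) \<le> 2 ^ ((m + l - 2) div 2)"
    unfolding exps using power_strict_increasing[OF hm, of "2::nat"] by simp_all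
  show ?code
  proof (rule code_of_weight_distribution[OF card_n subspace_code cc W])
    show "(2 ^ (m - 2) - 2 ^ ((m + l - 2) div 2), 2 ^ (2 * m - 2 * l - 2) - 2 ^ (m - l - 2)) \<in> set ?ws"
      by simp
    have "(2::real) ^ (m - l - 2) < 2 ^ (2 * m - 2 * l - 2)"
      using lm by (intro power_strict_increasing) auto
    then show "(0::real) < 2 ^ (2 * m - 2 * l - 2) - 2 ^ (m - l - 2)" by simp
    show "0 < (2::nat) ^ (m - 2) - 2 ^ ((m + l - 2) div 2)" using lt by simp
    fix w A assume "(w, A) \<in> set ?ws"
    then have "w \<in> {0, 2 ^ (m - 2), 2 ^ (m - 2) + 2 ^ ((m + l - 2) div 2), 2 ^ (m - 2) - 2 ^ ((m + l - 2) div 2),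
        2 ^ (m - 2) + 2 ^ ((m + l - 4) div 2), 2 ^ (m - 2) - 2 ^ ((m + l - 4) div 2), 2 * 2 ^ (m - 2)}"
      unfolding \<open>2 * 2 ^ (m - 2) = 2 ^ (m - 1)\<close> by auto
    then show "w = 0 \<or> 2 ^ (m - 2) - 2 ^ ((m + l - 2) div 2) \<le> w"
      by (rule le_if_weight[OF lt(2)])
  qed
  show "is_code (dual_code code) (2 ^ (m - 1)) (2 ^ (m - 1) - 2 * m) 4" if "l \<ge> 2"
    using dual_is_code_4[OF cc m] that l by simp
  show "distance_optimal (dual_code code) (2 ^ (m - 1)) (2 ^ (m - 1) - 2 * m) 6" if "l = 1"
  proof -
    have "m \<noteq> 4" using r that by presburger
    then have m5: "m \<ge> 5" using m by simp
    show ?thesis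
      using that l distance_le_6[OF m5] double_less_two_power[OF m5]
      by (intro dual_distance_optimal_6[OF cc]) auto
  qed
qed

lemma parameters_coprime:
  assumes m4: "4 \<le> m" "m \<noteq> 4" and k: "0 < k"
    and v: "multiplicity 2 k < multiplicity 2 m" and l: "gcd m k = 1"
  shows "is_code code (2 ^ (m - 1)) (2 * m) (2 ^ (m - 2) - 2 ^ (m div 2))" (is ?code)
    and "has_weight_distribution code
         [(0, 1),
          (2 ^ (m - 2), 17 * 2 ^ (2 * m - 5) + 3 * 2 ^ (m - 3) - 2),
          (2 ^ (m - 2) + 2 ^ (m div 2), 1 / 3 * (2 ^ (2 * m - 6) - 2 ^ (m - 4))),
          (2 ^ (m - 2) - 2 ^ (m div 2), 1 / 3 * (2 ^ (2 * m - 6) - 2 ^ (m - 4))),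
          (2 ^ (m - 2) + 2 ^ ((m - 2) div 2), 1 / 6 * (11 * 2 ^ (2 * m - 3) - 2 ^ m)),
          (2 ^ (m - 2) - 2 ^ ((m - 2) div 2), 1 / 6 * (11 * 2 ^ (2 * m - 3) - 2 ^ m)),
          (2 ^ (m - 1), 1)]" (is "has_weight_distribution code ?ws")
    and "distance_optimal (dual_code code) (2 ^ (m - 1)) (2 ^ (m - 1) - 2 * m) 6"
proof -
  have m: "5 \<le> m" using m4 by simp
  have l': "gcd k m = 1" using l by (simp add: gcd.commute)
  have "even m"
  proof (rule ccontr)
    assume "odd m"
    then have "multiplicity 2 m = 0" by (rule not_dvd_imp_multiplicity_0)
    then show False using v by simp
  qed
  then obtain h' where h': "m = 2 * h'" by (rule evenE)
  have "coprime k (2 * h')" using l' by (simp only: h' coprime_iff_gcd_eq_1)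
  then have "coprime k h'" by simp
  then have g: "gcd (2 * k) m = 2"
    using gcd_mult_distrib_nat[of 2 k h'] by (simp add: h' coprime_iff_gcd_eq_1)
  define h where "h = h' - 1"
  have h: "m = 2 * h + 2" using h' m by (simp add: h_def)
  have exps: "m div 2 = h + 1" "(m - 2) div 2 = h" using h by simp_all
  \<comment> \<open>This is m/2 < m - 2, which fails at m = 4.\<close>
  have hm: "h + 1 < m - 2" using h m by linarith
  have m2: "2 \<le> m" using m by simp
  define Y :: nat where "Y = 2 ^ h"
  define A :: real where "A = 2 * real Y"
  have A4: "2 * A = 4 * real Y" by (simp add: A_def)
  have YX: "2 * Y < 2 ^ (m - 2)"
    using power_strict_increasing[OF hm, of "2::nat"] by (simp add: Y_def)
  have q: "2 ^ m / 2 = 2 * real (2 ^ (m - 2))"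
    using power_add[of "2::real" "m - 2" 2, unfolded le_add_diff_inverse2[OF m2]] by simp
  have A: "0 < A" "2 * A < 2 ^ m / 2"
  proof -
    have "real (2 * Y) < real (2 ^ (m - 2))" using YX by (simp only: of_nat_less_iff)
    then show "0 < A" "2 * A < 2 ^ m / 2" unfolding q A4 by (simp_all add: A_def Y_def)
  qed
  have "A ^ 2 = 2 ^ (2 * h + 2)"
    by (simp add: A_def Y_def power_add power_even_eq power_mult_distrib)
  then have A2: "A ^ 2 = 2 ^ m" by (simp only: h[symmetric])
  have small: "trace_sum a b \<in> {0, A, - A, 2 * A, - (2 * A)}" if a: "a \<noteq> 0" for a b
  \<comment> \<open>A trivial radical gives S^2 = q = A^2, four elements give S^2 = 0 or 4q =
    (2A)^2; the same A covers both.\<close>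
  proof (cases "radical a = {0}")
    case True
    then show ?thesis using trace_sum_values_trivial_radical[of a A b] A2 by auto
  next
    case False
    then obtain w where "w \<in> radical a" "w \<noteq> 0" using zero_in_radical by blast
    then have "card (radical a) = 4" using card_radical a g by simp
    then show ?thesis using A2 by (intro trace_sum_values) (simp add: power_mult_distrib)
  qed
  have vals: "trace_sum a b \<in> {0, A, - A, 2 * A, - (2 * A), 2 ^ m / 2, - (2 ^ m / 2)}" for a b
    by (rule small_trace_sums(1)[OF A]) (fact small)
  have Q1: "freq (2 ^ m / 2) = 1" by (rule small_trace_sums(2)[OF A]) (fact small)
  have F: "freq (2 * A) = ((2 ^ m) ^ 2 / 64 - 2 ^ m / 16) / 3"
    "freq A = (11 * (2 ^ m) ^ 2 / 8 - 2 ^ m) / 6"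
    "freq 0 = (2 ^ m) ^ 2 - 2 - 2 * freq A - 2 * freq (2 * A)"
    using frequencies_coprime[OF A A2 l'] small by blast+
  have "4 \<le> m" using m by simp
  note N = multiplicities_coprime[OF this F]
  have "2 * 2 ^ (m - 2) = (2::nat) ^ (m - 1)"
    using m by (simp flip: power_Suc add: Suc_diff_le)
  moreover have "2 * Y = 2 ^ (m div 2)" "Y = 2 ^ ((m - 2) div 2)"
    unfolding exps by (simp_all add: Y_def)
  moreover have "has_weight_distribution code
    [(0, 1), (2 ^ (m - 2), freq 0), (2 ^ (m - 2) + 2 * Y, freq (2 * A)), (2 ^ (m - 2) - 2 * Y, freq (2 * A)),
     (2 ^ (m - 2) + Y, freq A), (2 ^ (m - 2) - Y, freq A), (2 * 2 ^ (m - 2), 1)]"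
    using m YX vals Q1 by (intro weight_distribution_seven) (auto simp: A4 A_def Y_def)
  ultimately show W: "has_weight_distribution code ?ws"
    unfolding N by (simp only:)
  have cc: "card code = 2 ^ (2 * m)" by (rule card_code_faithful[OF Q1])
  have lt: "(2::nat) ^ (m div 2) < 2 ^ (m - 2)" "(2::nat) ^ ((m - 2) div 2) \<le> 2 ^ (m div 2)"
    unfolding exps using power_strict_increasing[OF hm, of "2::nat"] by simp_all
  show ?code
  proof (rule code_of_weight_distribution[OF card_n subspace_code cc W])
    show "(2 ^ (m - 2) - 2 ^ (m div 2), 1 / 3 * (2 ^ (2 * m - 6) - 2 ^ (m - 4))) \<in> set ?ws"
      by simp
    have "(2::real) ^ (m - 4) < 2 ^ (2 * m - 6)"
      using m by (intro power_strict_increasing) auto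
    then show "(0::real) < 1 / 3 * (2 ^ (2 * m - 6) - 2 ^ (m - 4))" by simp
    show "0 < (2::nat) ^ (m - 2) - 2 ^ (m div 2)" using lt by simp
    fix w A assume "(w, A) \<in> set ?ws"
    then have "w \<in> {0, 2 ^ (m - 2), 2 ^ (m - 2) + 2 ^ (m div 2), 2 ^ (m - 2) - 2 ^ (m div 2),
        2 ^ (m - 2) + 2 ^ ((m - 2) div 2), 2 ^ (m - 2) - 2 ^ ((m - 2) div 2), 2 * 2 ^ (m - 2)}"
      unfolding \<open>2 * 2 ^ (m - 2) = 2 ^ (m - 1)\<close> by auto
    then show "w = 0 \<or> 2 ^ (m - 2) - 2 ^ (m div 2) \<le> w"
      by (rule le_if_weight[OF lt(2)])
  qed
  show "distance_optimal (dual_code code) (2 ^ (m - 1)) (2 ^ (m - 1) - 2 * m) 6"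
    using l' distance_le_6[OF m] double_less_two_power[OF m]
    by (intro dual_distance_optimal_6[OF cc]) auto
qed

lemma parameters_half:
  assumes m: "4 \<le> m" and km: "2 * k = m"
  shows "is_code code (2 ^ (m - 1)) (3 * m div 2) (2 ^ (m - 2) - 2 ^ ((m - 2) div 2))" (is ?code)
    and "has_weight_distribution code
         [(0, 1),
          (2 ^ (m - 2), 2 ^ (3 * m div 2 - 1) + 2 ^ (m - 1) - 2),
          (2 ^ (m - 2) + 2 ^ ((m - 2) div 2), 2 ^ (3 * m div 2 - 2) - 2 ^ (m - 2)),
          (2 ^ (m - 2) - 2 ^ ((m - 2) div 2), 2 ^ (3 * m div 2 - 2) - 2 ^ (m - 2)),
          (2 ^ (m - 1), 1)]" (is "has_weight_distribution code ?ws")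
    and "is_code (dual_code code) (2 ^ (m - 1)) (2 ^ (m - 1) - 3 * m div 2) 4" (is ?dual)
    and "m \<noteq> 4 \<Longrightarrow> distance_optimal (dual_code code) (2 ^ (m - 1)) (2 ^ (m - 1) - 3 * m div 2) 4"
proof -
  note mk = km[symmetric]
  have k: "k \<ge> 2" using m mk by simp
  have vals: "trace_sum a b \<in> {0, 2 ^ k, - (2 ^ k), 2 ^ m / 2, - (2 ^ m / 2)}" for a b
    by (rule frequencies_half(1)[OF mk k])
  note QK = frequencies_half(2)[OF mk k]
  note N = multiplicities_half[OF k mk frequencies_half(3,4)[OF mk k]]
  define Y :: nat where "Y = 2 ^ (k - 1)"
  have Y2: "2 * real Y = 2 ^ k" using k by (simp add: Y_def flip: power_Suc)
  have exps: "(m - 2) div 2 = k - 1" "3 * m div 2 = 3 * k" using mk by auto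
  have YX: "Y < 2 ^ (m - 2)"
    unfolding Y_def using mk k by (intro power_strict_increasing) auto
  have "2 * 2 ^ (m - 2) = (2::nat) ^ (m - 1)"
    using m by (simp flip: power_Suc add: Suc_diff_le)
  moreover have "Y = 2 ^ ((m - 2) div 2)" by (simp add: exps Y_def)
  moreover have "has_weight_distribution code
    [(0, 1), (2 ^ (m - 2), 2 ^ (3 * m div 2 - 1) + 2 ^ (m - 1) - 2),
     (2 ^ (m - 2) + Y, 2 ^ (3 * m div 2 - 2) - 2 ^ (m - 2)),
     (2 ^ (m - 2) - Y, 2 ^ (3 * m div 2 - 2) - 2 ^ (m - 2)), (2 * 2 ^ (m - 2), 1)]"
  proof (rule weight_distribution_five)
    show "trace_sum a b \<in> {0, 2 * real Y, - (2 * real Y), 2 ^ m / 2, - (2 ^ m / 2)}" for a b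
      unfolding Y2 by (rule vals)
  qed (use m YX N in \<open>simp_all only: Y2 QK\<close>, simp_all add: Y_def)
  ultimately show W: "has_weight_distribution code ?ws" by (simp only:)
  \<comment> \<open>The kernel has 2^k elements, so the dimension drops from 2m = 4k to 3k.\<close>
  have "real (card code) * 2 ^ k = (2 ^ m) ^ 2" using card_code QK by simp
  also have "\<dots> = 2 ^ (3 * k) * 2 ^ k"
    unfolding mk by (simp flip: power_add power_mult)
  finally have "real (card code) = real (2 ^ (3 * m div 2))" by (simp add: exps)
  then have cc: "card code = 2 ^ (3 * m div 2)" by (simp only: of_nat_eq_iff)
  have lt: "(2::nat) ^ ((m - 2) div 2) < 2 ^ (m - 2)"
    using YX by (simp add: exps Y_def)
  show ?code
  proof (rule code_of_weight_distribution[OF card_n subspace_code cc W])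
    show "(2 ^ (m - 2) - 2 ^ ((m - 2) div 2), 2 ^ (3 * m div 2 - 2) - 2 ^ (m - 2)) \<in> set ?ws"
      by simp
    have "(2::real) ^ (m - 2) < 2 ^ (3 * m div 2 - 2)"
      using mk k by (intro power_strict_increasing) auto
    then show "(0::real) < 2 ^ (3 * m div 2 - 2) - 2 ^ (m - 2)" by simp
    show "0 < (2::nat) ^ (m - 2) - 2 ^ ((m - 2) div 2)" using lt by simp
    fix w A assume "(w, A) \<in> set ?ws"
    then have "w \<in> {0, 2 ^ (m - 2), 2 ^ (m - 2) + 2 ^ ((m - 2) div 2), 2 ^ (m - 2) - 2 ^ ((m - 2) div 2),
        2 ^ (m - 2) + 2 ^ ((m - 2) div 2), 2 ^ (m - 2) - 2 ^ ((m - 2) div 2), 2 * 2 ^ (m - 2)}"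
      unfolding \<open>2 * 2 ^ (m - 2) = 2 ^ (m - 1)\<close> by auto
    then show "w = 0 \<or> 2 ^ (m - 2) - 2 ^ ((m - 2) div 2) \<le> w"
      by (rule le_if_weight[OF order.refl])
  qed
  have "gcd k m = k" using mk by simp
  then show dual: ?dual using dual_is_code_4[OF cc m] k by simp
  show "distance_optimal (dual_code code) (2 ^ (m - 1)) (2 ^ (m - 1) - 3 * m div 2) 4" if "m \<noteq> 4"
  proof -
    have "k \<ge> 3" using that mk k by simp
    then have "d \<le> 4" if "is_code S (2 ^ (m - 1)) (2 ^ (m - 1) - 3 * m div 2) d" for S :: "(bit ^ 'n) set" and d
      using distance_le_4[of k S d] that unfolding exps by (simp only: mk)
    then show ?thesis using dual by (fastforce simp: distance_optimal_def)
  qed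
qed

end

text \<open>At m = 4 two claims fail and are excluded. In case (2) the weight 2^(m-2) - 2^(m/2)
  would be 0. In case (3) the dual is an [8,2,4] code, whereas the words 11111000 and 00011111 span
  an [8,2,5] code.\<close>

theorem theorem4p2:
  fixes m k l :: nat
    and f :: "'a::finite_field \<Rightarrow> 'a"
    and D :: "'a set"
    and e :: "'n::finite \<Rightarrow> 'a"
    and C :: "(bit ^ 'n) set"
  assumes field_card: "CARD('a) = 2 ^ m"
    and m: "m \<ge> 4"
    and k: "0 < k" "k < m"
    and l: "l = gcd k m"
    and f: "f = (\<lambda>x. x ^ (2 ^ k + 1))"
    and D: "D = {x. x \<noteq> 0 \<and> abs_trace m x = 1}"
    and e: "bij_betw e UNIV D"
    and C: "C = punctured_code m f e"
  shows
    "(multiplicity 2 m \<le> multiplicity 2 k \<longrightarrow>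
       is_code C (2 ^ (m - 1)) (2 * m) (2 ^ (m - 2) - 2 ^ ((m + l - 2) div 2)) \<and>
       has_weight_distribution C
         [(0, 1),
          (2 ^ (m - 2),
             2 ^ (2 * m) - 2 ^ (2 * m - l + 1) + 3 * 2 ^ (2 * m - 2 * l - 1) + 2 ^ (m - l - 1) - 2),
          (2 ^ (m - 2) + 2 ^ ((m + l - 2) div 2), 2 ^ (2 * m - 2 * l - 2) - 2 ^ (m - l - 2)),
          (2 ^ (m - 2) - 2 ^ ((m + l - 2) div 2), 2 ^ (2 * m - 2 * l - 2) - 2 ^ (m - l - 2)),
          (2 ^ (m - 2) + 2 ^ ((m + l - 4) div 2), 2 ^ (2 * m - l) - 2 ^ (2 * m - 2 * l)),
          (2 ^ (m - 2) - 2 ^ ((m + l - 4) div 2), 2 ^ (2 * m - l) - 2 ^ (2 * m - 2 * l)),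
          (2 ^ (m - 1), 1)] \<and>
       (l \<ge> 2 \<longrightarrow> is_code (dual_code C) (2 ^ (m - 1)) (2 ^ (m - 1) - 2 * m) 4) \<and>
       (l = 1 \<longrightarrow>
          is_code (dual_code C) (2 ^ (m - 1)) (2 ^ (m - 1) - 2 * m) 6 \<and>
          distance_optimal (dual_code C) (2 ^ (m - 1)) (2 ^ (m - 1) - 2 * m) 6)) \<and>
     (multiplicity 2 m > multiplicity 2 k \<and> gcd m k = 1 \<and> m \<noteq> 4 \<longrightarrow>
       is_code C (2 ^ (m - 1)) (2 * m) (2 ^ (m - 2) - 2 ^ (m div 2)) \<and>
       has_weight_distribution C
         [(0, 1),
          (2 ^ (m - 2), 17 * 2 ^ (2 * m - 5) + 3 * 2 ^ (m - 3) - 2),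
          (2 ^ (m - 2) + 2 ^ (m div 2), 1 / 3 * (2 ^ (2 * m - 6) - 2 ^ (m - 4))),
          (2 ^ (m - 2) - 2 ^ (m div 2), 1 / 3 * (2 ^ (2 * m - 6) - 2 ^ (m - 4))),
          (2 ^ (m - 2) + 2 ^ ((m - 2) div 2), 1 / 6 * (11 * 2 ^ (2 * m - 3) - 2 ^ m)),
          (2 ^ (m - 2) - 2 ^ ((m - 2) div 2), 1 / 6 * (11 * 2 ^ (2 * m - 3) - 2 ^ m)),
          (2 ^ (m - 1), 1)] \<and>
       is_code (dual_code C) (2 ^ (m - 1)) (2 ^ (m - 1) - 2 * m) 6 \<and>
       distance_optimal (dual_code C) (2 ^ (m - 1)) (2 ^ (m - 1) - 2 * m) 6) \<and>
     (2 * k = m \<longrightarrow>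
       is_code C (2 ^ (m - 1)) (3 * m div 2) (2 ^ (m - 2) - 2 ^ ((m - 2) div 2)) \<and>
       has_weight_distribution C
         [(0, 1),
          (2 ^ (m - 2), 2 ^ (3 * m div 2 - 1) + 2 ^ (m - 1) - 2),
          (2 ^ (m - 2) + 2 ^ ((m - 2) div 2), 2 ^ (3 * m div 2 - 2) - 2 ^ (m - 2)),
          (2 ^ (m - 2) - 2 ^ ((m - 2) div 2), 2 ^ (3 * m div 2 - 2) - 2 ^ (m - 2)),
          (2 ^ (m - 1), 1)] \<and>
       is_code (dual_code C) (2 ^ (m - 1)) (2 ^ (m - 1) - 3 * m div 2) 4 \<and>
       (m \<noteq> 4 \<longrightarrow>
          distance_optimal (dual_code C) (2 ^ (m - 1)) (2 ^ (m - 1) - 3 * m div 2) 4))"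
proof -
  interpret binary_field "TYPE('a)" m
    by unfold_locales (fact field_card)
  have "D = D1" unfolding D D1_def by auto
  then interpret gold_code "TYPE('a)" m k e
    using e by unfold_locales simp
  have C: "C = code" unfolding C f by (rule punctured_code_eq)
  have opt: "distance_optimal S n \<kappa> d \<Longrightarrow> is_code S n \<kappa> d" for S :: "(bit ^ 'n) set" and n \<kappa> d
    by (simp add: distance_optimal_def)
  note c1 = parameters_multiplicity_le[OF m k l] and c2 = parameters_coprime[OF m _ k(1)] and c3 = parameters_half[OF m]
  show ?thesis
    unfolding C
    by (intro conjI impI; (elim conjE)?;
        (rule c1(1,2) c2(1,2) c3 c1(3,4) c1(4)[THEN opt] c2(3) c2(3)[THEN opt]; assumption))
qed

end
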